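(* Let $L/K$ be ramified with $\Delta=\pi$ as in the context and let $n\ge1$. Then $\{[u_\alpha\mathcal{O}_n]:\alpha\in R(p)^n\}$ is exactly the set of vertices $x$ of the Bruhat–Tits tree with $d(x,[\mathcal{O}_0])=n$ whose geodesic to $[\mathcal{O}_0]$ does not pass through $[\pi\mathcal{O}_0]$. Analogously, $\{[u_\alpha\pi\mathcal{O}_n]:\alpha\in R(p)^n\}$ is exactly the set of vertices $x$ with $d(x,[\pi\mathcal{O}_0])=n$ whose geodesic to $[\pi\mathcal{O}_0]$ does not pass through $[\mathcal{O}_0]$.
   Context: $K$ is a nonarchimedean local field of characteristic zero with ring of integers $\mathcal{O}_K$, uniformizer $p$, residue field of size $q$. $L/K$ is a ramified quadratic extension and $\pi$ is a uniformizer of $L$ with minimal polynomial $X^2-\tau X+\delta$, $v_p(\tau)\ge1$, $v_p(\delta)=1$; $\mathcal{O}_n=\mathcal{O}_K[p^n\pi]$ ($\mathcal{O}_0=\mathcal{O}_L$). $R(p)\subset\mathcal{O}_K$ is a set of representatives of $\mathcal{O}_K/p\mathcal{O}_K$. For $i\ge0$, $t\in R(p)$, $u^{(i)}_t=1+tp^i\pi$; for $\alpha=(\alpha_0,\dots,\alpha_{n-1})\in R(p)^n$, $u_\alpha=u^{(0)}_{\alpha_0}u^{(1)}_{\alpha_1}\cdots u^{(n-1)}_{\alpha_{n-1}}$. The Bruhat–Tits tree of $SL(2,K)$ has as vertices the $K^*$-homothety classes $[\Lambda]$ of $\mathcal{O}_K$-lattices in $L$, adjacent iff representatives satisfy $p\Lambda\subsetneq\Lambda'\subsetneq\Lambda$;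 $d$ is graph distance. *)

theory Defs
  imports
    "HOL-Computational_Algebra.Polynomial"
    "HOL-Library.FuncSet"
    "Graph_Theory.Shortest_Path"
begin

section \<open>Discretely valued fields\<close>

text \<open>
  A valuation is a function \<open>v :: 'a \<Rightarrow> int\<close> whose value at \<open>0\<close> is irrelevant; the convention
  \<open>v 0 = \<infinity>\<close> is built into \<open>val_ge\<close>, which stands for \<open>v x \<ge> N\<close>.
\<close>

definition val_ge :: "('a::field \<Rightarrow> int) \<Rightarrow> int \<Rightarrow> 'a \<Rightarrow> bool" where
  "val_ge v N x \<longleftrightarrow> x = 0 \<or> N \<le> v x"

definition discrete_valuation :: "('a::field \<Rightarrow> int) \<Rightarrow> bool" where
  "discrete_valuation v \<longleftrightarrow>
     (\<forall>x y. x \<noteq> 0 \<longrightarrow> y \<noteq> 0 \<longrightarrow> v (x * y) = v x + v y) \<and>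
     (\<forall>x y. x \<noteq> 0 \<longrightarrow> y \<noteq> 0 \<longrightarrow> x + y \<noteq> 0 \<longrightarrow> min (v x) (v y) \<le> v (x + y)) \<and>
     v ` (- {0}) = UNIV"

definition val_ring :: "('a::field \<Rightarrow> int) \<Rightarrow> 'a set" where
  "val_ring v = {x. val_ge v 0 x}"

definition uniformizer :: "('a::field \<Rightarrow> int) \<Rightarrow> 'a \<Rightarrow> bool" where
  "uniformizer v p \<longleftrightarrow> p \<noteq> 0 \<and> v p = 1"

definition val_complete :: "('a::field \<Rightarrow> int) \<Rightarrow> bool" where
  "val_complete v \<longleftrightarrow>
     (\<forall>X :: nat \<Rightarrow> 'a.
        (\<forall>N. \<exists>M. \<forall>m\<ge>M. \<forall>n\<ge>M. val_ge v N (X m - X n)) \<longrightarrow>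
        (\<exists>l. \<forall>N. \<exists>M. \<forall>n\<ge>M. val_ge v N (X n - l)))"

definition residue_classes :: "('a::field \<Rightarrow> int) \<Rightarrow> 'a set set" where
  "residue_classes v =
     val_ring v // {(x, y). x \<in> val_ring v \<and> y \<in> val_ring v \<and> val_ge v 1 (x - y)}"

definition nonarch_local_field :: "('a::field \<Rightarrow> int) \<Rightarrow> bool" where
  "nonarch_local_field v \<longleftrightarrow>
     discrete_valuation v \<and> val_complete v \<and> finite (residue_classes v)"

definition residue_reps :: "('a::field \<Rightarrow> int) \<Rightarrow> 'a \<Rightarrow> 'a set \<Rightarrow> bool" where
  "residue_reps v p R \<longleftrightarrow>
     R \<subseteq> val_ring v \<and> (\<forall>x\<in>val_ring v. \<exists>!r. r \<in> R \<and> x - r \<in> (*) p ` val_ring v)"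

section \<open>Ramified quadratic extensions\<close>

definition field_embedding :: "('k::field \<Rightarrow> 'l::field) \<Rightarrow> bool" where
  "field_embedding \<iota> \<longleftrightarrow>
     \<iota> 1 = 1 \<and> (\<forall>x y. \<iota> (x + y) = \<iota> x + \<iota> y) \<and> (\<forall>x y. \<iota> (x * y) = \<iota> x * \<iota> y)"

abbreviation (input) emb_scale :: "('k::field \<Rightarrow> 'l::field) \<Rightarrow> 'k \<Rightarrow> 'l \<Rightarrow> 'l" where
  "emb_scale \<iota> \<equiv> (\<lambda>c x. \<iota> c * x)"

text \<open>
  \<open>w\<close> is the normalized valuation of the extension field, and \<open>e\<close> is the ramification index.
\<close>

definition ramified_quadratic_ext ::
  "('k::field \<Rightarrow> 'l::field) \<Rightarrow> ('k \<Rightarrow> int) \<Rightarrow> ('l \<Rightarrow> int) \<Rightarrow> bool" where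
  "ramified_quadratic_ext \<iota> v w \<longleftrightarrow>
     field_embedding \<iota> \<and>
     vector_space.dim (emb_scale \<iota>) (UNIV :: 'l set) = 2 \<and>
     discrete_valuation w \<and>
     (\<exists>e::nat. e > 1 \<and> (\<forall>x. x \<noteq> 0 \<longrightarrow> w (\<iota> x) = int e * v x))"

definition is_min_poly :: "('k::field \<Rightarrow> 'l::field) \<Rightarrow> 'k poly \<Rightarrow> 'l \<Rightarrow> bool" where
  "is_min_poly \<iota> f x \<longleftrightarrow>
     lead_coeff f = 1 \<and> poly (map_poly \<iota> f) x = 0 \<and>
     (\<forall>g. g \<noteq> 0 \<longrightarrow> poly (map_poly \<iota> g) x = 0 \<longrightarrow> degree f \<le> degree g)"

definition ring_adjoin :: "'l::comm_ring_1 set \<Rightarrow> 'l \<Rightarrow> 'l set" where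
  "ring_adjoin A x = {poly f x | f. \<forall>i. coeff f i \<in> A}"

definition quad_order ::
  "('k::field \<Rightarrow> 'l::field) \<Rightarrow> ('k \<Rightarrow> int) \<Rightarrow> 'k \<Rightarrow> 'l \<Rightarrow> nat \<Rightarrow> 'l set" where
  "quad_order \<iota> v p \<pi> n = ring_adjoin (\<iota> ` val_ring v) (\<iota> (p ^ n) * \<pi>)"

definition unit_prod ::
  "('k::field \<Rightarrow> 'l::field) \<Rightarrow> 'k \<Rightarrow> 'l \<Rightarrow> nat \<Rightarrow> (nat \<Rightarrow> 'k) \<Rightarrow> 'l" where
  "unit_prod \<iota> p \<pi> n \<alpha> = (\<Prod>i<n. 1 + \<iota> (\<alpha> i * p ^ i) * \<pi>)"

section \<open>Lattices and the Bruhat--Tits tree\<close>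

text \<open>
  A lattice is a finitely generated module over the valuation ring that spans the extension
  field over the base field.
\<close>

definition is_lattice ::
  "('k::field \<Rightarrow> 'l::field) \<Rightarrow> ('k \<Rightarrow> int) \<Rightarrow> 'l set \<Rightarrow> bool" where
  "is_lattice \<iota> v \<Lambda> \<longleftrightarrow>
     (\<exists>B. finite B \<and> \<Lambda> = {\<Sum>b\<in>B. \<iota> (c b) * b | c. \<forall>b\<in>B. c b \<in> val_ring v}) \<and>
     module.span (emb_scale \<iota>) \<Lambda> = UNIV"

definition homothety_class :: "('k::field \<Rightarrow> 'l::field) \<Rightarrow> 'l set \<Rightarrow> 'l set set" where
  "homothety_class \<iota> \<Lambda> = {(*) (\<iota> c) ` \<Lambda> | c. c \<noteq> 0}"

text \<open>
  The tree is encoded as a digraph. The arc relation is symmetric: the inclusions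
  \<open>p\<Lambda> \<subset> \<Lambda>' \<subset> \<Lambda>\<close> give \<open>p\<Lambda>' \<subset> p\<Lambda> \<subset> \<Lambda>'\<close>.
\<close>

definition bruhat_tits_tree ::
  "('k::field \<Rightarrow> 'l::field) \<Rightarrow> ('k \<Rightarrow> int) \<Rightarrow> 'k \<Rightarrow>
     ('l set set, 'l set set \<times> 'l set set) pre_digraph" where
  "bruhat_tits_tree \<iota> v p =
     \<lparr> verts = {homothety_class \<iota> \<Lambda> | \<Lambda>. is_lattice \<iota> v \<Lambda>},
       arcs = {(homothety_class \<iota> \<Lambda>, homothety_class \<iota> \<Lambda>') | \<Lambda> \<Lambda>'.
                 is_lattice \<iota> v \<Lambda> \<and> is_lattice \<iota> v \<Lambda>' \<and>
                 (*) (\<iota> p) ` \<Lambda> \<subset> \<Lambda>' \<and> \<Lambda>' \<subset> \<Lambda>},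
       tail = fst, head = snd \<rparr>"

definition graph_dist :: "('a, 'b) pre_digraph \<Rightarrow> 'a \<Rightarrow> 'a \<Rightarrow> ereal" where
  "graph_dist G x y = wf_digraph.\<mu> G (\<lambda>_. 1) x y"

definition is_geodesic :: "('a, 'b) pre_digraph \<Rightarrow> 'a \<Rightarrow> 'b awalk \<Rightarrow> 'a \<Rightarrow> bool" where
  "is_geodesic G x \<gamma> y \<longleftrightarrow>
     pre_digraph.awalk G x \<gamma> y \<and> ereal (real (length \<gamma>)) = graph_dist G x y"

text \<open>
  The universal quantifier below refers to the unique geodesic from \<open>x\<close> to \<open>y\<close> when \<open>G\<close> is
  a tree.
\<close>

definition geodesic_avoids :: "('a, 'b) pre_digraph \<Rightarrow> 'a \<Rightarrow> 'a \<Rightarrow> 'a \<Rightarrow> bool" where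
  "geodesic_avoids G x y z \<longleftrightarrow>
     (\<forall>\<gamma>. is_geodesic G x \<gamma> y \<longrightarrow> z \<notin> set (pre_digraph.awalk_verts G x \<gamma>))"

end

theory Submission
  imports Defs
begin

text \<open>
  Write \<open>\<O>\<close> for the valuation ring of \<open>K\<close>. The distance of \<open>[\<Lambda>]\<close> and \<open>[M]\<close> is at most
  \<open>m\<close> iff a multiple of \<open>\<Lambda>\<close> lies between \<open>p\<^sup>m M\<close> and \<open>M\<close>, and a geodesic to a vertex
  can avoid its neighbour \<open>z\<close> only if \<open>z\<close> is not nearer. In the coordinates \<open>a + b \<pi>\<close>, the lattices
  at distance \<open>n\<close> from \<open>\<O>\<^sub>0\<close> and not nearer to \<open>\<pi> \<O>\<^sub>0\<close> are then, up to homothety,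
  the \<open>\<O> (1 + b \<pi>) + p\<^sup>n \<O>\<^sub>0 = (1 + b \<pi>) \<O>\<^sub>n\<close> with \<open>b\<close> in \<open>\<O>\<close>.
  Each \<open>u\<^sub>\<alpha>\<close> is a unit of \<open>\<O>\<close> times some \<open>1 + b \<pi>\<close>, and conversely
  the digits \<open>\<alpha>\<close> for a given \<open>b\<close> are found one at a time. Multiplication by \<open>\<pi>\<close> is an
  automorphism of the tree that exchanges \<open>[\<O>\<^sub>0]\<close> and \<open>[\<pi> \<O>\<^sub>0]\<close>, because
  \<open>\<pi>\<^sup>2 \<O>\<^sub>0 = p \<O>\<^sub>0\<close>; this gives the second half.
\<close>

section \<open>Distances and geodesics in digraphs\<close>

context wf_digraph
begin

lemma awalk_cost_one: "awalk_cost (\<lambda>_. 1) \<gamma> = real (length \<gamma>)"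
  by (induct \<gamma>) auto

text \<open>Walk costs are natural numbers. If no walk has length at most \<open>m\<close>, each
  costs at least \<open>m + 1\<close>, and so does the infimum, also when there is no walk at all
  and it is infinite.\<close>

lemma graph_dist_le_iff:
  "graph_dist G x y \<le> ereal (real m) \<longleftrightarrow> (\<exists>\<gamma>. awalk x \<gamma> y \<and> length \<gamma> \<le> m)"
proof
  assume le: "graph_dist G x y \<le> ereal (real m)"
  show "\<exists>\<gamma>. awalk x \<gamma> y \<and> length \<gamma> \<le> m"
  proof (rule ccontr)
    assume "\<not> ?thesis"
    then have "ereal (real (Suc m)) \<le> graph_dist G x y"
      unfolding graph_dist_def \<mu>_def
      by (intro INF_greatest) (auto simp: awalk_cost_one not_le)
    with le have "ereal (real (Suc m)) \<le> ereal (real m)" by (rule order_trans[rotated])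
    then show False by simp
  qed
next
  assume "\<exists>\<gamma>. awalk x \<gamma> y \<and> length \<gamma> \<le> m"
  then obtain \<gamma> where \<gamma>: "awalk x \<gamma> y" "length \<gamma> \<le> m" by blast
  from min_cost_le_walk_cost[OF \<gamma>(1), of "\<lambda>_. 1"]
  have "graph_dist G x y \<le> ereal (real (length \<gamma>))"
    by (simp add: graph_dist_def awalk_cost_one)
  also have "\<dots> \<le> ereal (real m)" using \<gamma>(2) by simp
  finally show "graph_dist G x y \<le> ereal (real m)" .
qed

text \<open>By integrality an exact distance amounts to two bounds of the form treated by
  \<open>graph_dist_le_iff\<close>.\<close>

lemma graph_dist_eq_Suc_iff:
  "graph_dist G x y = ereal (real (Suc m)) \<longleftrightarrow>
     graph_dist G x y \<le> ereal (real (Suc m)) \<and> \<not> graph_dist G x y \<le> ereal (real m)"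
proof (intro iffI conjI)
  assume *: "graph_dist G x y \<le> ereal (real (Suc m)) \<and> \<not> graph_dist G x y \<le> ereal (real m)"
  then have "\<And>\<gamma>. awalk x \<gamma> y \<Longrightarrow> Suc m \<le> length \<gamma>"
    by (auto simp: graph_dist_le_iff not_le)
  then have "ereal (real (Suc m)) \<le> graph_dist G x y"
    unfolding graph_dist_def \<mu>_def
    by (intro INF_greatest) (auto simp: awalk_cost_one simp del: of_nat_Suc)
  with * show "graph_dist G x y = ereal (real (Suc m))" by (auto intro: antisym)
qed auto

text \<open>A walk of length at most \<open>m\<close> to \<open>z\<close>, prolonged by
  \<open>e\<close>, is a geodesic through \<open>z\<close>. Conversely a geodesic through
  \<open>z\<close> still has an arc to go at \<open>z\<close>, because \<open>z \<noteq> y\<close>,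
  so it reaches \<open>z\<close> within \<open>m\<close> steps. Uniqueness of geodesics does not
  enter.\<close>

lemma geodesic_avoids_iff:
  assumes e: "e \<in> arcs G" "tail G e = z" "head G e = y" and "z \<noteq> y"
    and dist: "graph_dist G x y = ereal (real (Suc m))"
  shows "geodesic_avoids G x y z \<longleftrightarrow> \<not> graph_dist G x z \<le> ereal (real m)"
proof (intro iffI notI)
  assume avoid: "geodesic_avoids G x y z" and "graph_dist G x z \<le> ereal (real m)"
  then obtain \<gamma> where \<gamma>: "awalk x \<gamma> z" "length \<gamma> \<le> m" by (auto simp: graph_dist_le_iff)
  have walk: "awalk x (\<gamma> @ [e]) y"
    using \<gamma>(1) arc_implies_awalk[OF e(1)] e by (auto intro: awalk_appendI)
  have "\<not> graph_dist G x y \<le> ereal (real m)" by (simp add: dist)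
  then have "Suc m \<le> length (\<gamma> @ [e])"
    using walk by (metis graph_dist_le_iff not_less_eq_eq)
  with \<gamma>(2) have "length (\<gamma> @ [e]) = Suc m" by simp
  then have "is_geodesic G x (\<gamma> @ [e]) y"
    using walk dist by (simp add: is_geodesic_def)
  moreover have "z \<in> set (awalk_verts x (\<gamma> @ [e]))"
    using awalk_verts_arc1[of e "\<gamma> @ [e]"] e by simp
  ultimately show False using avoid by (auto simp: geodesic_avoids_def)
next
  assume far: "\<not> graph_dist G x z \<le> ereal (real m)"
  show "geodesic_avoids G x y z"
    unfolding geodesic_avoids_def
  proof (intro allI impI notI)
    fix \<gamma> assume "is_geodesic G x \<gamma> y" and z: "z \<in> set (awalk_verts x \<gamma>)"
    then have \<gamma>: "awalk x \<gamma> y" "length \<gamma> = Suc m" by (auto simp: is_geodesic_def dist)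
    obtain q r where qr: "\<gamma> = q @ r" "awalk x q z" "awalk z r y"
      using awalk_decomp[OF \<gamma>(1) z] by blast
    have "r \<noteq> []" using qr(3) \<open>z \<noteq> y\<close> by (auto simp: awalk_Nil_iff)
    then have "length q \<le> m" using qr(1) \<gamma>(2) by (cases r) auto
    with qr(2) far show False by (auto simp: graph_dist_le_iff)
  qed
qed

end

section \<open>Valuation rings\<close>

locale discretely_valued_field =
  fixes v :: "'k::field \<Rightarrow> int" and p :: 'k
  assumes dv: "discrete_valuation v" and unif: "uniformizer v p"
begin

abbreviation \<O> :: "'k set" where "\<O> \<equiv> val_ring v"

lemma v_mult: "x \<noteq> 0 \<Longrightarrow> y \<noteq> 0 \<Longrightarrow> v (x * y) = v x + v y"
  using dv by (simp add: discrete_valuation_def)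

lemma v_add: "x \<noteq> 0 \<Longrightarrow> y \<noteq> 0 \<Longrightarrow> x + y \<noteq> 0 \<Longrightarrow> min (v x) (v y) \<le> v (x + y)"
  using dv by (simp add: discrete_valuation_def)

lemma p_nonzero [simp]: "p \<noteq> 0" and v_p [simp]: "v p = 1"
  using unif by (auto simp: uniformizer_def)

lemma v_one [simp]: "v 1 = 0"
  using v_mult[of 1 1] by simp

lemma v_minus_one: "v (- 1) = 0"
  using v_mult[of "- 1" "- 1"] by simp

lemma v_inverse: "x \<noteq> 0 \<Longrightarrow> v (inverse x) = - v x"
  using v_mult[of x "inverse x"] by simp

lemma v_power_p [simp]: "v (p ^ n) = int n"
  by (induct n) (auto simp: v_mult)

lemma mem_O_iff: "x \<in> \<O> \<longleftrightarrow> x = 0 \<or> 0 \<le> v x"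
  by (simp add: val_ring_def val_ge_def)

lemma O_zero [simp, intro]: "0 \<in> \<O>" and O_one [simp, intro]: "1 \<in> \<O>" and O_p [simp, intro]: "p \<in> \<O>"
  by (auto simp: mem_O_iff)

lemma O_add [intro]: "x \<in> \<O> \<Longrightarrow> y \<in> \<O> \<Longrightarrow> x + y \<in> \<O>"
  using v_add[of x y] by (cases "x = 0 \<or> y = 0 \<or> x + y = 0") (auto simp: mem_O_iff)

lemma O_mult [intro]: "x \<in> \<O> \<Longrightarrow> y \<in> \<O> \<Longrightarrow> x * y \<in> \<O>"
  using v_mult[of x y] by (cases "x = 0 \<or> y = 0") (auto simp: mem_O_iff)

lemma O_uminus [intro]: "x \<in> \<O> \<Longrightarrow> - x \<in> \<O>"
  using O_mult[of "- 1" x] by (auto simp: mem_O_iff v_minus_one)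

lemma O_diff [intro]: "x \<in> \<O> \<Longrightarrow> y \<in> \<O> \<Longrightarrow> x - y \<in> \<O>"
  using O_add[of x "- y"] by auto

lemma O_power [intro]: "x \<in> \<O> \<Longrightarrow> x ^ n \<in> \<O>"
  by (induct n) auto

lemma val_ge_one_iff: "val_ge v 1 x \<longleftrightarrow> x \<in> (*) p ` \<O>"
proof
  assume "val_ge v 1 x"
  then have "x * inverse p \<in> \<O>"
    by (cases "x = 0") (auto simp: val_ge_def mem_O_iff v_mult v_inverse)
  then show "x \<in> (*) p ` \<O>" by (intro image_eqI[of _ _ "x * inverse p"]) auto
next
  assume "x \<in> (*) p ` \<O>"
  then obtain y where "y \<in> \<O>" "x = p * y" by blast
  then show "val_ge v 1 x" by (cases "y = 0") (auto simp: val_ge_def mem_O_iff v_mult)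
qed

lemma p_mult_ne_one: "g \<in> \<O> \<Longrightarrow> p * g \<noteq> 1"
proof
  assume g: "g \<in> \<O>" and eq: "p * g = 1"
  then have "g \<noteq> 0" by auto
  with eq v_mult[of p g] g show False by (auto simp: mem_O_iff)
qed

lemma O_cases:
  assumes "x \<in> \<O>"
  obtains (multiple) y where "y \<in> \<O>" "x = p * y" | (unit) "x \<noteq> 0" "inverse x \<in> \<O>"
proof (cases "val_ge v 1 x")
  case True
  then show ?thesis using multiple by (auto simp: val_ge_one_iff)
next
  case False
  then have "x \<noteq> 0" "v x = 0" using assms by (auto simp: val_ge_def mem_O_iff)
  then show ?thesis using unit by (auto simp: mem_O_iff v_inverse)
qed

definition unit :: "'k \<Rightarrow> bool" where
  "unit x \<longleftrightarrow> x \<in> \<O> \<and> x \<noteq> 0 \<and> inverse x \<in> \<O>"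

lemma unitD: "unit x \<Longrightarrow> x \<in> \<O>" "unit x \<Longrightarrow> x \<noteq> 0" "unit x \<Longrightarrow> inverse x \<in> \<O>"
  by (auto simp: unit_def)

lemma unit_one [simp]: "unit 1"
  by (simp add: unit_def)

lemma unit_mult: "unit x \<Longrightarrow> unit y \<Longrightarrow> unit (x * y)"
  by (auto simp: unit_def inverse_mult_distrib)

text \<open>The ring is local with maximal ideal generated by \<open>p\<close>: if the sum were a
  multiple of \<open>p\<close>, so would be \<open>x\<close>, and hence \<open>1\<close>.\<close>

lemma unit_add_p:
  assumes "unit x" "y \<in> \<O>"
  shows "unit (x + p * y)"
proof -
  have mem: "x + p * y \<in> \<O>" using unitD(1)[OF assms(1)] assms(2) by auto
  then show ?thesis
  proof (cases rule: O_cases)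
    case (multiple z)
    then have "x = p * (z - y)" by (simp add: algebra_simps)
    then have "p * ((z - y) * inverse x) = 1"
      using unitD(2)[OF assms(1)] by (metis mult.assoc right_inverse)
    moreover have "(z - y) * inverse x \<in> \<O>" using multiple assms(2) unitD(3)[OF assms(1)] by auto
    ultimately show ?thesis using p_mult_ne_one by blast
  next
    case unit
    then show ?thesis using mem by (simp add: unit_def)
  qed
qed

text \<open>The cases are \<open>v x > n\<close> and \<open>v x \<le> n\<close>. In
  \<open>outward_imp_branch\<close> they decide whether a coordinate is small enough or else
  produces \<open>p ^ n\<close>.\<close>

lemma power_p_dvd_cases:
  obtains (multiple) y where "y \<in> \<O>" "x = p ^ Suc n * y"
    | (divisor) y where "y \<in> \<O>" "p ^ n = x * y"
proof (cases "val_ge v (int (Suc n)) x")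
  case True
  then have "x * inverse (p ^ Suc n) \<in> \<O>"
    by (cases "x = 0") (auto simp: val_ge_def mem_O_iff v_mult v_inverse simp del: power_Suc)
  moreover have "x = p ^ Suc n * (x * inverse (p ^ Suc n))" by (simp add: field_simps)
  ultimately show ?thesis by (rule multiple)
next
  case False
  then have "x \<noteq> 0" "v x \<le> int n" by (auto simp: val_ge_def)
  then have "p ^ n * inverse x \<in> \<O>" "p ^ n = x * (p ^ n * inverse x)"
    by (auto simp: mem_O_iff v_mult v_inverse)
  then show ?thesis by (rule divisor)
qed

end

section \<open>Lattices and distances in the tree\<close>

lemma times_image_times [simp]: "(*) a ` (*) b ` S = (*) (a * b :: 'a::semigroup_mult) ` S"
  by (auto simp: image_image mult.assoc)

lemma times_image_subset_iff:
  fixes a :: "'a::field"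
  assumes "a \<noteq> 0"
  shows "(*) a ` S \<subseteq> (*) a ` T \<longleftrightarrow> S \<subseteq> T"
  using assms by (auto simp: image_iff)

lemma times_image_commute: "(*) a ` (*) b ` S = (*) (b :: 'a::ab_semigroup_mult) ` (*) a ` S"
  by (metis mult.commute times_image_times)

lemma Collect_image_eqI:
  assumes "\<And>a. a \<in> A \<Longrightarrow> \<exists>b\<in>B. f a = g b" "\<And>b. b \<in> B \<Longrightarrow> \<exists>a\<in>A. g b = f a"
  shows "{f a | a. a \<in> A} = {g b | b. b \<in> B}"
  using assms by blast

locale valued_field_extension = discretely_valued_field v p
  for v :: "'k::field \<Rightarrow> int" and p +
  fixes \<iota> :: "'k \<Rightarrow> 'l::field"
  assumes emb: "field_embedding \<iota>"
begin

lemma emb_one [simp]: "\<iota> 1 = 1" and emb_add: "\<iota> (x + y) = \<iota> x + \<iota> y"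
  and emb_mult: "\<iota> (x * y) = \<iota> x * \<iota> y"
  using emb by (auto simp: field_embedding_def)

lemma emb_zero [simp]: "\<iota> 0 = 0"
  using emb_add[of 0 0] by (metis add_cancel_right_right add_0)

lemma emb_uminus: "\<iota> (- x) = - \<iota> x"
  using emb_add[of x "- x"] by (simp add: eq_neg_iff_add_eq_0 add.commute)

lemma emb_diff: "\<iota> (x - y) = \<iota> x - \<iota> y"
  using emb_add[of x "- y"] by (simp add: emb_uminus)

lemma emb_power: "\<iota> (x ^ n) = \<iota> x ^ n"
  by (induct n) (auto simp: emb_mult)

lemmas emb_simps = emb_add emb_mult emb_uminus emb_diff emb_power

lemma emb_eq_zero_iff [simp]: "\<iota> x = 0 \<longleftrightarrow> x = 0"
proof
  assume "\<iota> x = 0"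
  then have "\<iota> (x * inverse x) = 0" by (simp add: emb_mult)
  then show "x = 0" by (cases "x = 0") auto
qed simp

lemma emb_eq_iff [simp]: "\<iota> x = \<iota> y \<longleftrightarrow> x = y"
  using emb_eq_zero_iff[of "x - y"] by (simp add: emb_diff)

sublocale vs: vector_space "emb_scale \<iota>"
  by unfold_locales (auto simp: emb_simps algebra_simps)

declare vs.scale_scale [simp del] \<comment> \<open>loops with \<open>emb_mult\<close> and \<open>mult.assoc\<close>\<close>

abbreviation lattice :: "'l set \<Rightarrow> bool" where "lattice \<equiv> is_lattice \<iota> v"
abbreviation cls :: "'l set \<Rightarrow> 'l set set" where "cls \<equiv> homothety_class \<iota>"
abbreviation T where "T \<equiv> bruhat_tits_tree \<iota> v p"

section \<open>Lattices: module operations, multiples and sums\<close>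

lemma lattice_span: "lattice \<Lambda> \<Longrightarrow> vs.span \<Lambda> = UNIV"
  by (simp add: is_lattice_def)

lemma lattice_add:
  assumes "lattice \<Lambda>" "x \<in> \<Lambda>" "y \<in> \<Lambda>"
  shows "x + y \<in> \<Lambda>"
proof -
  obtain B where \<Lambda>: "\<Lambda> = {\<Sum>b\<in>B. \<iota> (c b) * b | c. \<forall>b\<in>B. c b \<in> \<O>}"
    using assms(1) by (auto simp: is_lattice_def)
  obtain c d where "x = (\<Sum>b\<in>B. \<iota> (c b) * b)" "\<forall>b\<in>B. c b \<in> \<O>"
    "y = (\<Sum>b\<in>B. \<iota> (d b) * b)" "\<forall>b\<in>B. d b \<in> \<O>"
    using assms(2,3) unfolding \<Lambda> by blast
  then have "x + y = (\<Sum>b\<in>B. \<iota> (c b + d b) * b)" "\<forall>b\<in>B. c b + d b \<in> \<O>"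
    by (auto simp: emb_add distrib_right sum.distrib)
  then show ?thesis unfolding \<Lambda> by (intro CollectI exI[of _ "\<lambda>b. c b + d b"] conjI)
qed

lemma lattice_scale:
  assumes "lattice \<Lambda>" "s \<in> \<O>" "x \<in> \<Lambda>"
  shows "\<iota> s * x \<in> \<Lambda>"
proof -
  obtain B where \<Lambda>: "\<Lambda> = {\<Sum>b\<in>B. \<iota> (c b) * b | c. \<forall>b\<in>B. c b \<in> \<O>}"
    using assms(1) by (auto simp: is_lattice_def)
  obtain c where x: "x = (\<Sum>b\<in>B. \<iota> (c b) * b)" and c: "\<forall>b\<in>B. c b \<in> \<O>"
    using assms(3) unfolding \<Lambda> by blast
  have "\<iota> s * x = (\<Sum>b\<in>B. \<iota> (s * c b) * b)"
    by (simp add: x emb_mult sum_distrib_left mult.assoc)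
  moreover have "\<forall>b\<in>B. s * c b \<in> \<O>" using assms(2) c by auto
  ultimately show ?thesis unfolding \<Lambda> by (intro CollectI exI[of _ "\<lambda>b. s * c b"] conjI)
qed

lemma lattice_diff:
  assumes "lattice \<Lambda>" "x \<in> \<Lambda>" "y \<in> \<Lambda>"
  shows "x - y \<in> \<Lambda>"
  using lattice_add[OF assms(1,2) lattice_scale[OF assms(1) O_uminus[OF O_one] assms(3)]]
  by (simp add: emb_uminus)

lemma lattice_zero:
  assumes "lattice \<Lambda>"
  shows "0 \<in> \<Lambda>"
proof -
  obtain B where \<Lambda>: "\<Lambda> = {\<Sum>b\<in>B. \<iota> (c b) * b | c. \<forall>b\<in>B. c b \<in> \<O>}"
    using assms(1) by (auto simp: is_lattice_def)
  show ?thesis unfolding \<Lambda> by (intro CollectI exI[of _ "\<lambda>_. 0"]) auto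
qed

lemma lattice_times:
  assumes "lattice \<Lambda>" "a \<noteq> 0"
  shows "lattice ((*) a ` \<Lambda>)"
proof -
  obtain B where B: "finite B" and \<Lambda>: "\<Lambda> = {\<Sum>b\<in>B. \<iota> (c b) * b | c. \<forall>b\<in>B. c b \<in> \<O>}"
    using assms(1) by (auto simp: is_lattice_def)
  have inj: "inj_on ((*) a) B" using assms(2) by (auto simp: inj_on_def)
  have sums: "(\<Sum>b\<in>(*) a ` B. \<iota> (c b) * b) = a * (\<Sum>b\<in>B. \<iota> (c (a * b)) * b)" for c
    by (simp add: sum.reindex[OF inj] sum_distrib_left mult.left_commute)
  have "(*) a ` \<Lambda> = {\<Sum>b\<in>(*) a ` B. \<iota> (c b) * b | c. \<forall>b\<in>(*) a ` B. c b \<in> \<O>}"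
  proof (intro equalityI subsetI)
    fix x assume "x \<in> (*) a ` \<Lambda>"
    then obtain c where "x = a * (\<Sum>b\<in>B. \<iota> (c b) * b)" "\<forall>b\<in>B. c b \<in> \<O>"
      unfolding \<Lambda> by blast
    then show "x \<in> {\<Sum>b\<in>(*) a ` B. \<iota> (c b) * b | c. \<forall>b\<in>(*) a ` B. c b \<in> \<O>}"
      \<comment> \<open>The coefficients are transported along the bijection
        \<open>b \<mapsto> a * b\<close> of the generators.\<close>
      using assms(2) by (intro CollectI exI[of _ "\<lambda>b. c (inverse a * b)"])
        (auto simp: sums simp flip: mult.assoc)
  next
    fix x assume "x \<in> {\<Sum>b\<in>(*) a ` B. \<iota> (c b) * b | c. \<forall>b\<in>(*) a ` B. c b \<in> \<O>}"
    then show "x \<in> (*) a ` \<Lambda>" unfolding \<Lambda> by (auto simp: sums)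
  qed
  moreover have "x \<in> vs.span ((*) a ` \<Lambda>)" for x
  proof -
    have "inverse a * x \<in> vs.span \<Lambda>" by (simp add: lattice_span[OF assms(1)])
    \<comment> \<open>Multiplication by \<open>a\<close> is linear over the base field, so it maps
      the span of \<Lambda> into the span of the image; the induction follows linear
      combinations.\<close>
    then have "a * (inverse a * x) \<in> vs.span ((*) a ` \<Lambda>)"
    proof (induct rule: vs.span_induct_alt)
      case (step c y z)
      have "\<iota> c * (a * y) + a * z \<in> vs.span ((*) a ` \<Lambda>)"
        using step by (intro vs.span_add vs.span_scale) (auto intro: vs.span_base)
      then show ?case by (simp add: algebra_simps)
    qed (simp add: vs.span_zero)
    moreover have "a * (inverse a * x) = x" using assms(2) by (simp flip: mult.assoc)
    ultimately show ?thesis by simp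
  qed
  ultimately show ?thesis unfolding is_lattice_def using B by blast
qed

text \<open>Supplies the intermediate lattices of the walk in \<open>awalk_of_subsets\<close>. The
  union of the two generating sets generates the sum; only generators in both sets need
  care.\<close>

lemma lattice_sum:
  assumes "lattice \<Lambda>" "lattice M"
  shows "lattice {x + y | x y. x \<in> \<Lambda> \<and> y \<in> M}"
proof -
  let ?S = "{x + y | x y. x \<in> \<Lambda> \<and> y \<in> M}"
  obtain B where B: "finite B" and \<Lambda>: "\<Lambda> = {\<Sum>b\<in>B. \<iota> (c b) * b | c. \<forall>b\<in>B. c b \<in> \<O>}"
    using assms(1) by (auto simp: is_lattice_def)
  obtain C where C: "finite C" and M: "M = {\<Sum>b\<in>C. \<iota> (c b) * b | c. \<forall>b\<in>C. c b \<in> \<O>}"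
    using assms(2) by (auto simp: is_lattice_def)
  have "?S = {\<Sum>b\<in>B \<union> C. \<iota> (c b) * b | c. \<forall>b\<in>B \<union> C. c b \<in> \<O>}"
  proof (intro equalityI subsetI)
    fix x assume "x \<in> ?S"
    then obtain c d where x: "x = (\<Sum>b\<in>B. \<iota> (c b) * b) + (\<Sum>b\<in>C. \<iota> (d b) * b)"
      and c: "\<forall>b\<in>B. c b \<in> \<O>" and d: "\<forall>b\<in>C. d b \<in> \<O>"
      unfolding \<Lambda> M by blast
    \<comment> \<open>Extension by zero brings both combinations to the index set
      \<open>B \<union> C\<close>, where the coefficients of shared generators add up.\<close>
    define c' d' where "c' b = (if b \<in> B then c b else 0)"
      and "d' b = (if b \<in> C then d b else 0)" for b
    have "(\<Sum>b\<in>B. \<iota> (c b) * b) = (\<Sum>b\<in>B \<union> C. \<iota> (c' b) * b)"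
      using B C by (intro sum.mono_neutral_cong_left) (auto simp: c'_def)
    moreover have "(\<Sum>b\<in>C. \<iota> (d b) * b) = (\<Sum>b\<in>B \<union> C. \<iota> (d' b) * b)"
      using B C by (intro sum.mono_neutral_cong_left) (auto simp: d'_def)
    ultimately have "x = (\<Sum>b\<in>B \<union> C. \<iota> (c' b + d' b) * b)"
      by (simp add: x emb_add distrib_right sum.distrib)
    moreover have "\<forall>b\<in>B \<union> C. c' b + d' b \<in> \<O>" using c d by (auto simp: c'_def d'_def)
    ultimately show "x \<in> {\<Sum>b\<in>B \<union> C. \<iota> (c b) * b | c. \<forall>b\<in>B \<union> C. c b \<in> \<O>}"
      by (intro CollectI exI[of _ "\<lambda>b. c' b + d' b"] conjI)
  next
    fix x assume "x \<in> {\<Sum>b\<in>B \<union> C. \<iota> (c b) * b | c. \<forall>b\<in>B \<union> C. c b \<in> \<O>}"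
    then obtain c where x: "x = (\<Sum>b\<in>B \<union> C. \<iota> (c b) * b)" and c: "\<forall>b\<in>B \<union> C. c b \<in> \<O>"
      by blast
    \<comment> \<open>Shared generators are assigned wholly to \<Lambda>, so the part in
      \<open>M\<close> has coefficient 0 there.\<close>
    define d where "d b = (if b \<in> B then 0 else c b)" for b
    have "(\<Sum>b\<in>B \<union> C. \<iota> (c b) * b) = (\<Sum>b\<in>B. \<iota> (c b) * b) + (\<Sum>b\<in>C - B. \<iota> (c b) * b)"
      using sum.union_disjoint[of B "C - B" "\<lambda>b. \<iota> (c b) * b"] B C by (simp add: Un_Diff_cancel)
    also have "(\<Sum>b\<in>C - B. \<iota> (c b) * b) = (\<Sum>b\<in>C. \<iota> (d b) * b)"
      using B C by (intro sum.mono_neutral_cong_left) (auto simp: d_def)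
    finally have "x = (\<Sum>b\<in>B. \<iota> (c b) * b) + (\<Sum>b\<in>C. \<iota> (d b) * b)" by (simp add: x)
    moreover have "(\<Sum>b\<in>B. \<iota> (c b) * b) \<in> \<Lambda>" using c unfolding \<Lambda> by blast
    moreover have "(\<Sum>b\<in>C. \<iota> (d b) * b) \<in> M"
      unfolding M using c by (intro CollectI exI[of _ d]) (auto simp: d_def)
    ultimately show "x \<in> ?S" by blast
  qed
  moreover have "\<Lambda> \<subseteq> ?S"
    using lattice_zero[OF assms(2)] by force
  then have "vs.span ?S = UNIV"
    using vs.span_mono[of \<Lambda> ?S] lattice_span[OF assms(1)] by auto
  ultimately show ?thesis unfolding is_lattice_def using B C by blast
qed

section \<open>Homothety classes and lattices between p^m M and M\<close>

lemma cls_times: "c \<noteq> 0 \<Longrightarrow> cls ((*) (\<iota> c) ` \<Lambda>) = cls \<Lambda>"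
proof -
  assume c: "c \<noteq> 0"
  have "(\<exists>d. S = (*) (\<iota> d * \<iota> c) ` \<Lambda> \<and> d \<noteq> 0) \<longleftrightarrow> (\<exists>d. S = (*) (\<iota> d) ` \<Lambda> \<and> d \<noteq> 0)" for S
  proof
    assume "\<exists>d. S = (*) (\<iota> d * \<iota> c) ` \<Lambda> \<and> d \<noteq> 0"
    then show "\<exists>d. S = (*) (\<iota> d) ` \<Lambda> \<and> d \<noteq> 0"
      using c by (metis emb_mult no_zero_divisors)
  next
    assume "\<exists>d. S = (*) (\<iota> d) ` \<Lambda> \<and> d \<noteq> 0"
    then obtain d where "S = (*) (\<iota> d) ` \<Lambda>" "d \<noteq> 0" by blast
    then show "\<exists>d. S = (*) (\<iota> d * \<iota> c) ` \<Lambda> \<and> d \<noteq> 0"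
      using c by (intro exI[of _ "d * inverse c"]) (simp add: mult.assoc flip: emb_mult)
  qed
  then show ?thesis by (simp add: homothety_class_def)
qed

lemma cls_eqD:
  assumes "cls \<Lambda> = cls M"
  obtains c where "c \<noteq> 0" "\<Lambda> = (*) (\<iota> c) ` M"
proof -
  have "\<Lambda> \<in> cls \<Lambda>" unfolding homothety_class_def by (intro CollectI exI[of _ 1]) auto
  then have "\<Lambda> \<in> cls M" by (simp only: assms)
  then show ?thesis using that unfolding homothety_class_def by auto
qed

text \<open>The walk-free form of the bound \<open>m\<close> on the distance of the two classes, see
  \<open>graph_dist_le_iff_lat_within\<close>. Scaling \<Lambda> alone is enough, since a factor on
  \<open>M\<close> can be moved into \<open>c\<close>.\<close>

definition lat_within :: "nat \<Rightarrow> 'l set \<Rightarrow> 'l set \<Rightarrow> bool" where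
  "lat_within m \<Lambda> M \<longleftrightarrow>
     (\<exists>c. c \<noteq> 0 \<and> (*) (\<iota> (p ^ m)) ` M \<subseteq> (*) (\<iota> c) ` \<Lambda> \<and> (*) (\<iota> c) ` \<Lambda> \<subseteq> M)"

lemma lat_within_mono:
  assumes "lattice M" "lat_within k \<Lambda> M" "k \<le> m"
  shows "lat_within m \<Lambda> M"
proof -
  have "(*) (\<iota> (p ^ m)) ` M \<subseteq> (*) (\<iota> (p ^ k)) ` M"
  proof -
    have "(*) (\<iota> (p ^ m)) ` M = (*) (\<iota> (p ^ k)) ` (*) (\<iota> (p ^ (m - k))) ` M"
      using assms(3) by (simp flip: emb_mult power_add)
    moreover have "(*) (\<iota> (p ^ (m - k))) ` M \<subseteq> M"
      using assms(1) by (auto intro!: lattice_scale O_power)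
    ultimately show ?thesis by (metis image_mono)
  qed
  then show ?thesis using assms(2) unfolding lat_within_def by (meson order_trans)
qed

text \<open>Scale so that \<open>A'\<close> lies between \<open>p ^ m\<close> times \<open>M\<close>
  and \<open>M\<close>. As \<open>p A \<subseteq> A' \<subseteq> A\<close>, the lattice
  \<open>p A\<close> then lies between \<open>p ^ Suc m\<close> times \<open>M\<close> and
  \<open>M\<close>.\<close>

lemma lat_within_step:
  assumes arc: "(cls \<Lambda>, cls \<Lambda>') \<in> arcs T" and near: "lat_within m \<Lambda>' M"
  shows "lat_within (Suc m) \<Lambda> M"
proof -
  obtain A A' where cls: "cls \<Lambda> = cls A" "cls \<Lambda>' = cls A'"
    and A: "(*) (\<iota> p) ` A \<subseteq> A'" "A' \<subseteq> A"
    using arc unfolding bruhat_tits_tree_def by auto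
  obtain a where a: "a \<noteq> 0" "\<Lambda> = (*) (\<iota> a) ` A" using cls(1) by (rule cls_eqD)
  obtain b where b: "b \<noteq> 0" "\<Lambda>' = (*) (\<iota> b) ` A'" using cls(2) by (rule cls_eqD)
  obtain c where c: "c \<noteq> 0" "(*) (\<iota> (p ^ m)) ` M \<subseteq> (*) (\<iota> (c * b)) ` A'"
    "(*) (\<iota> (c * b)) ` A' \<subseteq> M"
    using near unfolding lat_within_def b(2) by (auto simp: emb_mult)
  \<comment> \<open>The scalar for \<Lambda>: \<open>inverse a\<close> returns from \<Lambda> to the
    representative \<open>A\<close>, \<open>c * b\<close> is the scaling of \<open>A'\<close>, and
    \<open>p\<close> is the loss caused by the arc.\<close>
  have *: "(*) (\<iota> (p * c * b * inverse a)) ` \<Lambda> = (*) (\<iota> (c * b)) ` (*) (\<iota> p) ` A"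
  proof -
    have "p * c * b * inverse a * a = c * b * p" using a(1) by simp
    then show ?thesis unfolding a(2) times_image_times by (metis emb_mult)
  qed
  have "(*) (\<iota> p) ` (*) (\<iota> (p ^ m)) ` M \<subseteq> (*) (\<iota> p) ` (*) (\<iota> (c * b)) ` A"
    using c(2) A(2) by (intro image_mono) (meson image_mono order_trans)
  then have "(*) (\<iota> (p ^ Suc m)) ` M \<subseteq> (*) (\<iota> (p * c * b * inverse a)) ` \<Lambda>"
    unfolding * by (simp only: times_image_times power_Suc mult.commute[of "\<iota> p"] emb_mult)
  moreover have "(*) (\<iota> (p * c * b * inverse a)) ` \<Lambda> \<subseteq> M"
    unfolding * using A(1) c(3) by (meson image_mono order_trans)
  moreover have "p * c * b * inverse a \<noteq> 0" using a b c by simp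
  ultimately show ?thesis unfolding lat_within_def by blast
qed

section \<open>Arcs, walks and the distance formula\<close>

sublocale tree: wf_digraph T
  by unfold_locales (auto simp: bruhat_tits_tree_def)

lemma cls_in_verts: "lattice \<Lambda> \<Longrightarrow> cls \<Lambda> \<in> verts T"
  by (auto simp: bruhat_tits_tree_def)

lemma vertsE:
  assumes "x \<in> verts T"
  obtains \<Lambda> where "lattice \<Lambda>" "x = cls \<Lambda>"
  using assms by (auto simp: bruhat_tits_tree_def)

lemma vertex_sets_eqI:
  assumes "S \<subseteq> verts T" "S' \<subseteq> verts T" "\<And>\<Lambda>. lattice \<Lambda> \<Longrightarrow> cls \<Lambda> \<in> S \<longleftrightarrow> cls \<Lambda> \<in> S'"
  shows "S = S'"
proof (rule set_eqI)
  fix x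
  show "x \<in> S \<longleftrightarrow> x \<in> S'"
  proof (cases "x \<in> verts T")
    case True
    then obtain \<Lambda> where "lattice \<Lambda>" "x = cls \<Lambda>" by (rule vertsE)
    then show ?thesis using assms(3) by simp
  next
    case False
    then show ?thesis using assms(1,2) by blast
  qed
qed

lemma tree_tail [simp]: "tail T e = fst e" and tree_head [simp]: "head T e = snd e"
  by (simp_all add: bruhat_tits_tree_def)

lemma arcI:
  assumes "lattice \<Lambda>" "lattice N" "(*) (\<iota> p) ` N \<subset> \<Lambda>" "\<Lambda> \<subset> N"
  shows "(cls N, cls \<Lambda>) \<in> arcs T"
  unfolding bruhat_tits_tree_def using assms by auto

text \<open>The reverse of the arc in \<open>arcI\<close>: replace \<open>N\<close> by the
  homothetic lattice \<open>p N\<close>, which lies between \<open>p \<Lambda>\<close> and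
  \<Lambda>.\<close>

lemma arcI':
  assumes "lattice \<Lambda>" "lattice N" "(*) (\<iota> p) ` N \<subset> \<Lambda>" "\<Lambda> \<subset> N"
  shows "(cls \<Lambda>, cls N) \<in> arcs T"
proof -
  have "(*) (\<iota> p) ` \<Lambda> \<subset> (*) (\<iota> p) ` N"
    using assms(4) by (simp add: subset_not_subset_eq times_image_subset_iff)
  moreover have "lattice ((*) (\<iota> p) ` N)" using assms(2) by (simp add: lattice_times)
  ultimately have "(cls \<Lambda>, cls ((*) (\<iota> p) ` N)) \<in> arcs T" using assms(1,3) by (intro arcI)
  then show ?thesis by (simp add: cls_times)
qed

text \<open>The induction strips the first arc, so \<open>M\<close> stays fixed and
  \<open>lat_within_step\<close> pays one factor \<open>p\<close> per arc.\<close>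

lemma lat_within_of_awalk:
  assumes "tree.awalk (cls \<Lambda>) \<gamma> (cls M)"
  shows "lat_within (length \<gamma>) \<Lambda> M"
  using assms
proof (induct \<gamma> arbitrary: \<Lambda>)
  case Nil
  then have "cls M = cls \<Lambda>" by (auto simp: tree.awalk_Nil_iff)
  then obtain c where "c \<noteq> 0" "M = (*) (\<iota> c) ` \<Lambda>" by (rule cls_eqD)
  then show ?case unfolding lat_within_def by (intro exI[of _ c]) auto
next
  case (Cons e \<gamma>)
  then have e: "e \<in> arcs T" "fst e = cls \<Lambda>" and walk: "tree.awalk (snd e) \<gamma> (cls M)"
    by (auto simp: tree.awalk_Cons_iff)
  from walk have "snd e \<in> verts T" by (rule tree.awalk_hd_in_verts)
  then obtain N where N: "snd e = cls N" by (rule vertsE)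
  then have "e = (cls \<Lambda>, cls N)" using e(2) by (simp add: prod_eq_iff)
  then show ?case using lat_within_step Cons.hyps walk N e(1) by simp
qed

text \<open>The walk runs through the lattices \<open>\<Lambda> + p\<^sup>k M\<close>, \<open>k \<le> m\<close>; consecutive ones are adjacent
  or homothetic.\<close>

lemma awalk_of_subsets:
  assumes "lattice \<Lambda>" "lattice M" "(*) (\<iota> (p ^ m)) ` M \<subseteq> \<Lambda>" "\<Lambda> \<subseteq> M"
  shows "\<exists>\<gamma>. tree.awalk (cls \<Lambda>) \<gamma> (cls M) \<and> length \<gamma> \<le> m"
  using assms
proof (induct m arbitrary: \<Lambda>)
  case 0
  then have "\<Lambda> = M" by auto
  with 0 show ?case by (intro exI[of _ "[]"]) (auto simp: tree.awalk_Nil_iff cls_in_verts)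
next
  case (Suc m)
  let ?pM = "(*) (\<iota> (p ^ m)) ` M"
  define N where "N = {x + y | x y. x \<in> \<Lambda> \<and> y \<in> ?pM}"
  have pM: "lattice ?pM" using Suc.prems by (simp add: lattice_times)
  have N: "lattice N" unfolding N_def by (rule lattice_sum[OF Suc.prems(1) pM])
  have "?pM \<subseteq> N" unfolding N_def using lattice_zero[OF Suc.prems(1)] by force
  moreover have "?pM \<subseteq> M" using Suc.prems(2) by (auto intro!: lattice_scale O_power)
  then have "N \<subseteq> M" unfolding N_def using Suc.prems(2,4) by (auto intro!: lattice_add)
  ultimately obtain \<gamma> where \<gamma>: "tree.awalk (cls N) \<gamma> (cls M)" "length \<gamma> \<le> m"
    using Suc.hyps[OF N Suc.prems(2)] by blast
  have "\<Lambda> \<subseteq> N" unfolding N_def using lattice_zero[OF pM] by force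
  moreover have "(*) (\<iota> p) ` N \<subseteq> \<Lambda>"
  proof
    fix z assume "z \<in> (*) (\<iota> p) ` N"
    then obtain x y where xy: "x \<in> \<Lambda>" "y \<in> M" and z: "z = \<iota> p * (x + \<iota> (p ^ m) * y)"
      unfolding N_def by auto
    have "\<iota> (p ^ Suc m) * y \<in> \<Lambda>" using Suc.prems(3) xy by blast
    moreover have "\<iota> p * x \<in> \<Lambda>" using xy Suc.prems(1) by (auto intro: lattice_scale)
    ultimately have "\<iota> p * x + \<iota> (p ^ Suc m) * y \<in> \<Lambda>" using Suc.prems(1) lattice_add by blast
    then show "z \<in> \<Lambda>" by (simp add: z emb_simps algebra_simps)
  qed
  \<comment> \<open>If \<Lambda> equals \<open>N\<close> or \<open>p N\<close>, the class does not
    change and no arc is added; this is why the walk may be shorter than \<open>m\<close>.\<close>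
  ultimately consider "cls \<Lambda> = cls N" | "(*) (\<iota> p) ` N \<subset> \<Lambda>" "\<Lambda> \<subset> N"
    using cls_times[OF p_nonzero, of N] by (metis psubsetI)
  then show ?case
  proof cases
    case 1
    then show ?thesis using \<gamma> by (intro exI[of _ \<gamma>]) auto
  next
    case 2
    then have "(cls \<Lambda>, cls N) \<in> arcs T" using arcI' Suc.prems(1) N by blast
    then have "tree.awalk (cls \<Lambda>) ((cls \<Lambda>, cls N) # \<gamma>) (cls M)"
      using \<gamma> by (simp add: tree.awalk_Cons_iff)
    then show ?thesis using \<gamma>(2) by (metis Suc_le_mono length_Cons)
  qed
qed

lemma graph_dist_le_iff_lat_within:
  assumes "lattice \<Lambda>" "lattice M"
  shows "graph_dist T (cls \<Lambda>) (cls M) \<le> ereal (real m) \<longleftrightarrow> lat_within m \<Lambda> M"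
proof
  assume "graph_dist T (cls \<Lambda>) (cls M) \<le> ereal (real m)"
  then show "lat_within m \<Lambda> M"
    unfolding tree.graph_dist_le_iff
    using lat_within_of_awalk lat_within_mono[OF assms(2)] by blast
next
  assume "lat_within m \<Lambda> M"
  then obtain c where c: "c \<noteq> 0" "(*) (\<iota> (p ^ m)) ` M \<subseteq> (*) (\<iota> c) ` \<Lambda>" "(*) (\<iota> c) ` \<Lambda> \<subseteq> M"
    unfolding lat_within_def by blast
  have "lattice ((*) (\<iota> c) ` \<Lambda>)" using c assms by (simp add: lattice_times)
  from awalk_of_subsets[OF this assms(2) c(2,3)]
  show "graph_dist T (cls \<Lambda>) (cls M) \<le> ereal (real m)"
    using c(1) by (simp add: tree.graph_dist_le_iff cls_times)
qed

text \<open>Both conditions that define a sphere of the theorem become inclusions between lattices.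
  The radius is \<open>Suc m\<close>, so that "not nearer" reads as failure of the bound
  \<open>m\<close>.\<close>

lemma geodesic_avoids_iff_lat_within:
  assumes lat: "lattice \<Lambda>" "lattice M" "lattice Z"
    and arc: "(cls Z, cls M) \<in> arcs T" and ne: "cls Z \<noteq> cls M"
  shows "graph_dist T (cls \<Lambda>) (cls M) = ereal (real (Suc m)) \<and>
         geodesic_avoids T (cls \<Lambda>) (cls M) (cls Z) \<longleftrightarrow>
         lat_within (Suc m) \<Lambda> M \<and> \<not> lat_within m \<Lambda> M \<and> \<not> lat_within m \<Lambda> Z"
proof (cases "graph_dist T (cls \<Lambda>) (cls M) = ereal (real (Suc m))")
  case True
  then show ?thesis
    using tree.geodesic_avoids_iff[OF arc _ _ ne True] tree.graph_dist_eq_Suc_iff[of "cls \<Lambda>" "cls M" m]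
      graph_dist_le_iff_lat_within[OF lat(1,2)] graph_dist_le_iff_lat_within[OF lat(1,3)]
    by (metis fst_conv snd_conv tree_head tree_tail)
next
  case False
  then show ?thesis
    using tree.graph_dist_eq_Suc_iff[of "cls \<Lambda>" "cls M" m] graph_dist_le_iff_lat_within[OF lat(1,2)]
    by metis
qed

section \<open>Invariance under homothety and under multiplication\<close>

lemma cls_times_cong:
  assumes "cls \<Lambda> = cls M"
  shows "cls ((*) a ` \<Lambda>) = cls ((*) a ` M)"
proof -
  obtain c where c: "c \<noteq> 0" "\<Lambda> = (*) (\<iota> c) ` M" using assms by (rule cls_eqD)
  then have "(*) a ` \<Lambda> = (*) (\<iota> c) ` (*) a ` M" by (simp only: times_image_commute[of a])
  then show ?thesis by (simp only: cls_times[OF c(1)])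
qed

text \<open>Passing through the distance, which sees only the classes, replaces a computation with
  scalars.\<close>

lemma lat_within_cong:
  assumes "lattice \<Lambda>" "lattice \<Lambda>'" "lattice M" "lattice M'" "cls \<Lambda> = cls \<Lambda>'" "cls M = cls M'"
  shows "lat_within m \<Lambda> M \<longleftrightarrow> lat_within m \<Lambda>' M'"
  using assms graph_dist_le_iff_lat_within[of \<Lambda> M m] graph_dist_le_iff_lat_within[of \<Lambda>' M' m] by simp

text \<open>Multiplication by \<open>a\<close> commutes with all scalars; this is how it acts as an
  automorphism of the tree.\<close>

lemma lat_within_times:
  assumes "a \<noteq> 0"
  shows "lat_within m ((*) a ` \<Lambda>) ((*) a ` M) \<longleftrightarrow> lat_within m \<Lambda> M"
proof -
  have "(*) x ` (*) a ` S = (*) a ` (*) x ` S" for x and S :: "'l set"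
    by (rule times_image_commute)
  then show ?thesis by (simp only: lat_within_def times_image_subset_iff[OF assms])
qed

end

section \<open>Coordinates in the quadratic extension\<close>

locale ramified_quadratic = valued_field_extension v p \<iota>
  for v :: "'k::field \<Rightarrow> int" and p and \<iota> :: "'k \<Rightarrow> 'l::field" +
  fixes \<pi> :: 'l and \<tau> \<delta> :: 'k
  assumes dim_two: "vector_space.dim (emb_scale \<iota>) (UNIV :: 'l set) = 2"
    and min_poly: "is_min_poly \<iota> [:\<delta>, - \<tau>, 1:] \<pi>"
    and v_tau: "val_ge v 1 \<tau>" and delta_nonzero: "\<delta> \<noteq> 0" and v_delta: "v \<delta> = 1"
begin

section \<open>Arithmetic in the basis 1, \<pi>\<close>

definition quad :: "'k \<Rightarrow> 'k \<Rightarrow> 'l" where "quad a b = \<iota> a + \<iota> b * \<pi>"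

lemma pi_square: "\<pi> * \<pi> = \<iota> \<tau> * \<pi> - \<iota> \<delta>"
proof -
  have "poly (map_poly \<iota> [:\<delta>, - \<tau>, 1:]) \<pi> = 0"
    using min_poly by (simp add: is_min_poly_def)
  then show ?thesis by (simp add: map_poly_pCons emb_uminus algebra_simps)
qed

text \<open>A linear relation between 1 and \<pi> is a polynomial of degree at most 1 that vanishes
  at \<pi>, while the minimal polynomial has degree 2.\<close>

lemma quad_eq_zero: "quad a b = 0 \<longleftrightarrow> a = 0 \<and> b = 0"
proof
  assume "quad a b = 0"
  then have "poly (map_poly \<iota> [:a, b:]) \<pi> = 0"
    by (simp add: map_poly_pCons quad_def mult.commute)
  moreover have "\<not> degree [:\<delta>, - \<tau>, 1:] \<le> degree [:a, b:]" by simp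
  ultimately have "[:a, b:] = 0" using min_poly unfolding is_min_poly_def by blast
  then show "a = 0 \<and> b = 0" by simp
qed (simp add: quad_def)

lemma quad_diff: "quad a b - quad c d = quad (a - c) (b - d)"
  by (simp add: quad_def emb_diff algebra_simps)

lemma quad_add: "quad a b + quad c d = quad (a + c) (b + d)"
  by (simp add: quad_def emb_add algebra_simps)

lemma quad_scale: "\<iota> c * quad a b = quad (c * a) (c * b)"
  by (simp add: quad_def emb_mult algebra_simps)

lemma quad_mult:
  "quad a b * quad c d = quad (a * c - b * d * \<delta>) (a * d + b * c + b * d * \<tau>)"
proof -
  have "quad a b * quad c d
      = \<iota> a * \<iota> c + (\<iota> a * \<iota> d + \<iota> b * \<iota> c) * \<pi> + \<iota> b * \<iota> d * (\<pi> * \<pi>)"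
    by (simp add: quad_def algebra_simps)
  then show ?thesis by (simp add: pi_square quad_def emb_simps algebra_simps)
qed

lemma quad_eq_iff: "quad a b = quad c d \<longleftrightarrow> a = c \<and> b = d"
  using quad_eq_zero[of "a - c" "b - d"] by (simp flip: quad_diff)

lemma quad_zero_one: "quad 0 1 = \<pi>" and quad_one_zero: "quad 1 0 = 1"
  by (simp_all add: quad_def)

lemma pi_nonzero: "\<pi> \<noteq> 0"
  using quad_eq_zero[of 0 1] by (simp add: quad_zero_one)

text \<open>In dimension 2 the independent elements 1 and \<pi> span: an element outside their span
  would give three independent ones.\<close>

lemma quad_exists: obtains a b where "z = quad a b"
proof -
  have indep: "vs.independent {\<pi>, 1}"
  proof (rule vs.independent_insertI)
    show "\<pi> \<notin> vs.span {1}"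
    proof
      assume "\<pi> \<in> vs.span {1}"
      then obtain k where "\<pi> = \<iota> k" by (auto simp: vs.span_singleton)
      then have "quad 0 1 = quad k 0" unfolding quad_def by simp
      then show False by (simp add: quad_eq_iff)
    qed
    show "vs.independent {1}" by (simp add: vs.independent_insert)
  qed
  obtain B where B: "vs.independent B" "UNIV \<subseteq> vs.span B" "card B = 2"
    using vs.basis_exists[of UNIV] dim_two by metis
  \<comment> \<open>Infinite sets have \<open>card\<close> 0, so cardinality 2 implies
    finiteness.\<close>
  have finB: "finite B" using B(3) card.infinite by fastforce
  have "z \<in> vs.span {\<pi>, 1}"
  proof (rule ccontr)
    assume z: "z \<notin> vs.span {\<pi>, 1}"
    then have "vs.independent {z, \<pi>, 1}" by (intro vs.independent_insertI indep)
    then have "card {z, \<pi>, 1} \<le> 2"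
      using vs.independent_span_bound[OF finB, of "{z, \<pi>, 1}"] B by auto
    moreover have "z \<notin> {\<pi>, 1}" using z vs.span_superset[of "{\<pi>, 1}"] by blast
    moreover have "\<pi> \<noteq> 1"
      using quad_eq_iff[of 0 1 1 0] by (simp add: quad_zero_one quad_one_zero)
    ultimately show False by simp
  qed
  then obtain b where "z - \<iota> b * \<pi> \<in> vs.span {1}" by (auto simp: vs.span_breakdown_eq)
  then obtain a where "z - \<iota> b * \<pi> = \<iota> a" by (auto simp: vs.span_singleton)
  then have "z = quad a b" by (simp add: quad_def algebra_simps)
  then show thesis by (rule that)
qed

section \<open>Units obtained from the Eisenstein condition on \<tau> and \<delta>\<close>

lemma tau_multiple: obtains \<tau>' where "\<tau>' \<in> \<O>" "\<tau> = p * \<tau>'"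
  using v_tau by (auto simp: val_ge_one_iff)

lemma delta_associate: obtains \<epsilon> where "unit \<epsilon>" "\<delta> = p * \<epsilon>"
proof
  show "\<delta> = p * (inverse p * \<delta>)" by simp
  show "unit (inverse p * \<delta>)"
    using delta_nonzero v_delta by (simp add: unit_def mem_O_iff v_mult v_inverse)
qed

lemma tau_mem [simp, intro]: "\<tau> \<in> \<O>"
  by (rule tau_multiple) auto

lemma delta_mem [simp, intro]: "\<delta> \<in> \<O>"
  using v_delta by (simp add: mem_O_iff)

text \<open>The expression is the norm of \<open>1 + b \<pi>\<close>, and it is congruent to 1
  modulo \<open>p\<close> because \<open>p\<close> divides \<tau> and \<delta>.\<close>

lemma unit_norm:
  assumes "b \<in> \<O>"
  shows "unit (1 + b * \<tau> + b * b * \<delta>)"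
proof -
  obtain \<tau>' where \<tau>': "\<tau>' \<in> \<O>" "\<tau> = p * \<tau>'" by (rule tau_multiple)
  obtain \<epsilon> where \<epsilon>: "unit \<epsilon>" "\<delta> = p * \<epsilon>" by (rule delta_associate)
  have "b * \<tau>' + b * b * \<epsilon> \<in> \<O>" using assms \<tau>' unitD(1)[OF \<epsilon>(1)] by auto
  then have "unit (1 + p * (b * \<tau>' + b * b * \<epsilon>))" by (intro unit_add_p unit_one)
  moreover have "1 + p * (b * \<tau>' + b * b * \<epsilon>) = 1 + b * \<tau> + b * b * \<delta>"
    by (simp add: \<tau>' \<epsilon> algebra_simps)
  ultimately show ?thesis by simp
qed

lemma unit_add_delta:
  assumes "unit c" "x \<in> \<O>"
  shows "unit (c + x * \<delta>)"
proof -
  obtain \<epsilon> where \<epsilon>: "unit \<epsilon>" "\<delta> = p * \<epsilon>" by (rule delta_associate)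
  have "unit (c + p * (x * \<epsilon>))" using assms unitD(1)[OF \<epsilon>(1)] by (intro unit_add_p) auto
  then show ?thesis by (simp add: \<epsilon> mult.left_commute)
qed

section \<open>The orders and \<pi> times the maximal order in coordinates\<close>

abbreviation ord :: "nat \<Rightarrow> 'l set" where "ord \<equiv> quad_order \<iota> v p \<pi>"

text \<open>The square of \<open>p ^ n \<pi>\<close> is an integral combination of 1 and
  \<open>p ^ n \<pi>\<close>, so powers above the first bring nothing new. The induction is Horner's
  scheme.\<close>

lemma quad_order_eq: "ord n = {quad a (p ^ n * b) | a b. a \<in> \<O> \<and> b \<in> \<O>}"
proof (intro equalityI subsetI)
  fix z assume "z \<in> ord n"
  then obtain f where "z = poly f (\<iota> (p ^ n) * \<pi>)" and f: "\<forall>i. coeff f i \<in> \<iota> ` \<O>"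
    unfolding quad_order_def ring_adjoin_def by blast
  moreover have "\<exists>a b. a \<in> \<O> \<and> b \<in> \<O> \<and> poly f (\<iota> (p ^ n) * \<pi>) = quad a (p ^ n * b)"
    using f
  proof (induct f)
    case 0
    have "poly 0 (\<iota> (p ^ n) * \<pi>) = quad 0 (p ^ n * 0)" by (simp add: quad_def)
    then show ?case by blast
  next
    case (pCons c f)
    from pCons.prems have "coeff (pCons c f) 0 \<in> \<iota> ` \<O>" by blast
    then obtain c' where c': "c' \<in> \<O>" "c = \<iota> c'" by auto
    from pCons.prems have "coeff (pCons c f) (Suc i) \<in> \<iota> ` \<O>" for i by blast
    then obtain a b where ab: "a \<in> \<O>" "b \<in> \<O>" "poly f (\<iota> (p ^ n) * \<pi>) = quad a (p ^ n * b)"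
      using pCons.hyps by auto
    have "poly (pCons c f) (\<iota> (p ^ n) * \<pi>) = quad c' 0 + quad 0 (p ^ n) * quad a (p ^ n * b)"
      by (simp add: c' ab(3)) (simp add: quad_def)
    also have "\<dots> = quad (c' - p ^ n * (p ^ n * b) * \<delta>) (p ^ n * (a + p ^ n * b * \<tau>))"
      by (simp add: quad_mult quad_add algebra_simps)
    finally have "poly (pCons c f) (\<iota> (p ^ n) * \<pi>) =
        quad (c' - p ^ n * (p ^ n * b) * \<delta>) (p ^ n * (a + p ^ n * b * \<tau>))" .
    moreover have "c' - p ^ n * (p ^ n * b) * \<delta> \<in> \<O>" "a + p ^ n * b * \<tau> \<in> \<O>"
      using ab(1,2) c'(1) by blast+
    ultimately show ?case by blast
  qed
  ultimately show "z \<in> {quad a (p ^ n * b) | a b. a \<in> \<O> \<and> b \<in> \<O>}" by blast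
next
  fix z assume "z \<in> {quad a (p ^ n * b) | a b. a \<in> \<O> \<and> b \<in> \<O>}"
  then obtain a b where ab: "a \<in> \<O>" "b \<in> \<O>" "z = quad a (p ^ n * b)" by blast
  have "z = poly [:\<iota> a, \<iota> b:] (\<iota> (p ^ n) * \<pi>)" by (simp add: ab quad_def emb_mult)
  moreover have "coeff [:\<iota> a, \<iota> b:] i \<in> \<iota> ` \<O>" for i
  proof -
    have "0 \<in> \<iota> ` \<O>" by (metis O_zero emb_zero image_eqI)
    then show ?thesis using ab by (auto simp: coeff_pCons split: nat.split)
  qed
  ultimately show "z \<in> ord n" unfolding quad_order_def ring_adjoin_def by blast
qed

lemma quad_mem_order: "quad a b \<in> ord n \<longleftrightarrow> a \<in> \<O> \<and> (\<exists>f\<in>\<O>. b = p ^ n * f)"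
  unfolding quad_order_eq by (auto simp: quad_eq_iff)

lemma quad_mem_order_zero: "quad a b \<in> ord 0 \<longleftrightarrow> a \<in> \<O> \<and> b \<in> \<O>"
  by (simp add: quad_mem_order)

lemma lattice_order: "lattice (ord n)"
  unfolding is_lattice_def
proof (intro conjI exI)
  let ?x = "quad 0 (p ^ n)"
  have ne: "1 \<noteq> ?x" using quad_eq_iff[of 1 0 0 "p ^ n"] by (simp add: quad_one_zero)
  have sums: "(\<Sum>b\<in>{1, ?x}. \<iota> (c b) * b) = quad (c 1) (p ^ n * c ?x)" for c
    using ne by (simp add: quad_scale quad_add mult.commute) (simp add: quad_def emb_mult)
  show "finite {1, ?x}" by simp
  show "ord n = {\<Sum>b\<in>{1, ?x}. \<iota> (c b) * b | c. \<forall>b\<in>{1, ?x}. c b \<in> \<O>}"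
  proof (intro equalityI subsetI)
    fix z assume "z \<in> ord n"
    then obtain a b where ab: "a \<in> \<O>" "b \<in> \<O>" "z = quad a (p ^ n * b)"
      unfolding quad_order_eq by blast
    then show "z \<in> {\<Sum>b\<in>{1, ?x}. \<iota> (c b) * b | c. \<forall>b\<in>{1, ?x}. c b \<in> \<O>}"
      unfolding sums using ne by (intro CollectI exI[of _ "\<lambda>y. if y = 1 then a else b"]) auto
  next
    fix z assume "z \<in> {\<Sum>b\<in>{1, ?x}. \<iota> (c b) * b | c. \<forall>b\<in>{1, ?x}. c b \<in> \<O>}"
    then show "z \<in> ord n" unfolding sums quad_order_eq by blast
  qed
  have "z \<in> vs.span (ord n)" for z
  proof -
    obtain a b where z: "z = quad a b" by (rule quad_exists)
    have mem: "quad 1 0 \<in> ord n" "quad 0 (p ^ n) \<in> ord n"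
      by (auto simp: quad_mem_order intro: bexI[of _ 0] bexI[of _ 1])
    have "z = \<iota> a * quad 1 0 + \<iota> (b * inverse (p ^ n)) * quad 0 (p ^ n)"
      by (simp add: z quad_scale quad_add mult.assoc)
    then show ?thesis using mem by (metis vs.span_add vs.span_base vs.span_scale)
  qed
  then show "vs.span (ord n) = UNIV" by blast
qed

text \<open>The product of \<pi> and \<open>x + y \<pi>\<close> has coordinates
  \<open>- y \<delta>\<close> and \<open>x + y \<tau>\<close>. As \<delta> is \<open>p\<close> times
  a unit, the first is an arbitrary multiple of \<open>p\<close>, and \<open>x\<close> then adjusts
  the second freely.\<close>

lemma quad_mem_pi_order:
  "quad a b \<in> (*) \<pi> ` ord 0 \<longleftrightarrow> (\<exists>f\<in>\<O>. a = p * f) \<and> b \<in> \<O>"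
proof -
  obtain \<epsilon> where \<epsilon>: "unit \<epsilon>" "\<delta> = p * \<epsilon>" by (rule delta_associate)
  note \<epsilon>O = unitD[OF \<epsilon>(1)]
  have pi_mult: "\<pi> * quad x y = quad (p * (- \<epsilon> * y)) (x + y * \<tau>)" for x y
    using quad_mult[of 0 1 x y] by (simp add: quad_zero_one \<epsilon> algebra_simps)
  show ?thesis
  proof
    assume "quad a b \<in> (*) \<pi> ` ord 0"
    then obtain x y where "x \<in> \<O>" "y \<in> \<O>" "quad a b = \<pi> * quad x y"
      by (auto simp: quad_order_eq)
    then show "(\<exists>f\<in>\<O>. a = p * f) \<and> b \<in> \<O>"
      using \<epsilon>O unfolding pi_mult quad_eq_iff by blast
  next
    assume "(\<exists>f\<in>\<O>. a = p * f) \<and> b \<in> \<O>"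
    then obtain f where f: "f \<in> \<O>" "a = p * f" and b: "b \<in> \<O>" by blast
    define y where "y = - (inverse \<epsilon> * f)"
    have y: "y \<in> \<O>" "- \<epsilon> * y = f"
      using f \<epsilon>O by (auto simp: y_def simp flip: mult.assoc)
    have "quad a b = \<pi> * quad (b - y * \<tau>) y" by (simp only: pi_mult y f) simp
    moreover have "quad (b - y * \<tau>) y \<in> ord 0" using b y by (auto simp: quad_mem_order_zero)
    ultimately show "quad a b \<in> (*) \<pi> ` ord 0" by blast
  qed
qed

text \<open>This is the ramification of the extension. It makes multiplication by \<pi> exchange the
  two base vertices.\<close>

lemma pi_pi_order: "(*) \<pi> ` (*) \<pi> ` ord 0 = (*) (\<iota> p) ` ord 0"
proof -
  obtain \<epsilon> where \<epsilon>: "unit \<epsilon>" "\<delta> = p * \<epsilon>" by (rule delta_associate)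
  note \<epsilon>O = unitD[OF \<epsilon>(1)]
  obtain \<tau>' where \<tau>': "\<tau>' \<in> \<O>" "\<tau> = p * \<tau>'" by (rule tau_multiple)
  have pi_mult: "\<pi> * quad x y = quad (p * (- \<epsilon> * y)) (x + y * \<tau>)" for x y
    using quad_mult[of 0 1 x y] by (simp add: quad_zero_one \<epsilon> algebra_simps)
  show ?thesis
  proof (intro equalityI subsetI)
    fix z assume "z \<in> (*) \<pi> ` (*) \<pi> ` ord 0"
    then obtain x where x: "x \<in> (*) \<pi> ` ord 0" "z = \<pi> * x" by blast
    obtain a b where ab: "x = quad a b" by (rule quad_exists)
    then obtain f where f: "f \<in> \<O>" "a = p * f" "b \<in> \<O>"
      using x(1) by (auto simp: quad_mem_pi_order)
    have "z = \<iota> p * quad (- \<epsilon> * b) (f + b * \<tau>')"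
      by (simp add: x ab pi_mult quad_scale f \<tau>' algebra_simps)
    moreover have "quad (- \<epsilon> * b) (f + b * \<tau>') \<in> ord 0"
      unfolding quad_mem_order_zero using f \<epsilon>O \<tau>' by blast
    ultimately show "z \<in> (*) (\<iota> p) ` ord 0" by blast
  next
    fix z assume "z \<in> (*) (\<iota> p) ` ord 0"
    then obtain a b where ab: "a \<in> \<O>" "b \<in> \<O>" "z = \<iota> p * quad a b"
      by (auto simp: quad_order_eq)
    \<comment> \<open>Chosen so that \<open>\<pi> * quad x y\<close> has first coordinate
      \<open>p * a\<close>; the second coordinate then dictates \<open>x\<close>.\<close>
    define y where "y = - (inverse \<epsilon> * a)"
    have y: "y \<in> \<O>" "- \<epsilon> * y = a"
      using ab \<epsilon>O by (auto simp: y_def simp flip: mult.assoc)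
    have "z = \<pi> * quad (p * (b - y * \<tau>')) y"
      unfolding pi_mult y(2) by (simp add: ab quad_scale \<tau>' algebra_simps)
    moreover have "quad (p * (b - y * \<tau>')) y \<in> (*) \<pi> ` ord 0"
      unfolding quad_mem_pi_order using y(1) ab \<tau>' by blast
    ultimately show "z \<in> (*) \<pi> ` (*) \<pi> ` ord 0" by blast
  qed
qed

section \<open>The lattices (1 + b \<pi>) times an order\<close>

abbreviation branch :: "nat \<Rightarrow> 'k \<Rightarrow> 'l set" where "branch n b \<equiv> (*) (quad 1 b) ` ord n"

lemma lattice_branch: "lattice (branch n b)"
  by (intro lattice_times lattice_order) (simp add: quad_eq_zero)

text \<open>With \<open>N\<close> the norm of \<open>1 + b \<pi>\<close>, the generator
  \<open>(1 + b \<pi>) p ^ n \<pi>\<close> equals \<open>p ^ n N \<pi>\<close> minus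
  \<open>p ^ n b \<delta> (1 + b \<pi>)\<close>. Since \<open>N\<close> is a unit,
  \<open>1 + b \<pi>\<close> and \<open>p ^ n \<pi>\<close> generate the lattice.\<close>

lemma quad_mem_branch:
  assumes b: "b \<in> \<O>"
  shows "quad a e \<in> branch n b \<longleftrightarrow> a \<in> \<O> \<and> (\<exists>f\<in>\<O>. e - a * b = p ^ n * f)"
proof -
  let ?N = "1 + b * \<tau> + b * b * \<delta>"
  have N: "?N \<in> \<O>" "?N \<noteq> 0" "inverse ?N \<in> \<O>" using unitD[OF unit_norm[OF b]] by auto
  have mult: "quad 1 b * quad x (p ^ n * y) =
      quad (x - p ^ n * b * y * \<delta>) ((x - p ^ n * b * y * \<delta>) * b + p ^ n * (y * ?N))" for x y
    by (simp add: quad_mult algebra_simps)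
  show ?thesis
  proof
    assume "quad a e \<in> branch n b"
    then obtain x y where xy: "x \<in> \<O>" "y \<in> \<O>" "quad a e = quad 1 b * quad x (p ^ n * y)"
      by (auto simp: quad_order_eq)
    then have a: "a = x - p ^ n * b * y * \<delta>" and e: "e = a * b + p ^ n * (y * ?N)"
      unfolding mult quad_eq_iff by auto
    have "a \<in> \<O>" unfolding a using xy b by blast
    moreover have "e - a * b = p ^ n * (y * ?N)" by (simp add: e)
    ultimately show "a \<in> \<O> \<and> (\<exists>f\<in>\<O>. e - a * b = p ^ n * f)" using xy N by blast
  next
    assume "a \<in> \<O> \<and> (\<exists>f\<in>\<O>. e - a * b = p ^ n * f)"
    then obtain f where f: "a \<in> \<O>" "f \<in> \<O>" "e - a * b = p ^ n * f" by blast
    \<comment> \<open>These solve \<open>mult\<close> for the coordinates \<open>a\<close> and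
      \<open>e\<close>: first divide by the norm, then undo the shift of the first
      coordinate.\<close>
    define y where "y = f * inverse ?N"
    define x where "x = a + p ^ n * b * y * \<delta>"
    have y: "y \<in> \<O>" "y * ?N = f" using f N by (auto simp: y_def mult.assoc)
    have "x \<in> \<O>" unfolding x_def using f b y by blast
    then have "quad x (p ^ n * y) \<in> ord n" using y by (auto simp: quad_mem_order)
    moreover have "quad a e = quad 1 b * quad x (p ^ n * y)"
      unfolding mult y(2) quad_eq_iff using f(3) by (simp add: x_def algebra_simps)
    ultimately show "quad a e \<in> branch n b" by blast
  qed
qed

text \<open>Membership makes \<open>b\<close> and \<open>b'\<close> congruent modulo
  \<open>p ^ n\<close>, and the description in \<open>quad_mem_branch\<close> depends on
  \<open>b\<close> only modulo \<open>p ^ n\<close>.\<close>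

lemma branch_cong:
  assumes "b \<in> \<O>" "b' \<in> \<O>" "quad 1 b \<in> branch n b'"
  shows "branch n b = branch n b'"
proof -
  obtain g where g: "g \<in> \<O>" "b - b' = p ^ n * g" using assms by (auto simp: quad_mem_branch)
  have "quad a e \<in> branch n b \<longleftrightarrow> quad a e \<in> branch n b'" for a e
  proof -
    have "(\<exists>f\<in>\<O>. e - a * b = p ^ n * f) \<longleftrightarrow> (\<exists>f\<in>\<O>. e - a * b' = p ^ n * f)" if a: "a \<in> \<O>"
    proof
      assume "\<exists>f\<in>\<O>. e - a * b = p ^ n * f"
      then obtain f where "f \<in> \<O>" "e - a * b = p ^ n * f" by blast
      then have "e - a * b' = p ^ n * (f + a * g)" "f + a * g \<in> \<O>"
        using g a by (auto simp: algebra_simps)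
      then show "\<exists>f\<in>\<O>. e - a * b' = p ^ n * f" by blast
    next
      assume "\<exists>f\<in>\<O>. e - a * b' = p ^ n * f"
      then obtain f where "f \<in> \<O>" "e - a * b' = p ^ n * f" by blast
      then have "e - a * b = p ^ n * (f - a * g)" "f - a * g \<in> \<O>"
        using g a by (auto simp: algebra_simps)
      then show "\<exists>f\<in>\<O>. e - a * b = p ^ n * f" by blast
    qed
    then show ?thesis using assms by (auto simp: quad_mem_branch)
  qed
  then show ?thesis by (metis quad_exists subsetI subset_antisym)
qed

text \<open>The common obstruction for both base vertices, since \<open>p ^ m \<pi>\<close> lies in
  \<open>p ^ m\<close> times either base lattice. Such an element of the scaled branch has first
  coordinate 0, so its second coordinate is divisible by \<open>p ^ Suc m\<close>, the scalar
  \<open>c\<close> being integral.\<close>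

lemma branch_not_within:
  assumes b: "b \<in> \<O>" and c: "c \<noteq> 0" "quad 0 (p ^ m) \<in> (*) (\<iota> c) ` branch (Suc m) b"
    "(*) (\<iota> c) ` branch (Suc m) b \<subseteq> ord 0"
  shows False
proof -
  have "quad 1 b \<in> branch (Suc m) b" using b by (auto simp: quad_mem_branch intro: bexI[of _ 0])
  then have "\<iota> c * quad 1 b \<in> ord 0" using c(3) by blast
  then have cO: "c \<in> \<O>" by (simp add: quad_scale quad_mem_order_zero)
  obtain z where z: "z \<in> branch (Suc m) b" "quad 0 (p ^ m) = \<iota> c * z" using c(2) by blast
  obtain a e where ae: "z = quad a e" by (rule quad_exists)
  then have "a = 0" and ce: "c * e = p ^ m" using z(2) c(1) by (auto simp: quad_scale quad_eq_iff)
  then obtain f where f: "f \<in> \<O>" "e = p ^ Suc m * f" using z(1) b by (auto simp: ae quad_mem_branch)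
  have "p ^ m * (p * (c * f)) = p ^ m" using ce by (simp add: f algebra_simps)
  then have "p * (c * f) = 1" by simp
  then show False using p_mult_ne_one cO f by blast
qed

section \<open>Lattices at distance m + 1 that are not nearer to the other base vertex\<close>

lemma pi_order_subset: "(*) \<pi> ` ord 0 \<subseteq> ord 0"
proof
  fix z assume z: "z \<in> (*) \<pi> ` ord 0"
  obtain a b where "z = quad a b" by (rule quad_exists)
  with z show "z \<in> ord 0" by (auto simp: quad_mem_pi_order quad_mem_order_zero)
qed

text \<open>The right-hand side of \<open>geodesic_avoids_iff_lat_within\<close> for the base vertex
  \<open>ord 0\<close> and its neighbour.\<close>

abbreviation outward :: "nat \<Rightarrow> 'l set \<Rightarrow> bool" where
  "outward m \<Lambda> \<equiv> lat_within (Suc m) \<Lambda> (ord 0) \<and> \<not> lat_within m \<Lambda> (ord 0) \<and>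
     \<not> lat_within m \<Lambda> ((*) \<pi> ` ord 0)"

lemma outward_branch:
  assumes b: "b \<in> \<O>"
  shows "outward m (branch (Suc m) b)"
proof (intro conjI)
  have "(*) (\<iota> (p ^ Suc m)) ` ord 0 \<subseteq> (*) (\<iota> 1) ` branch (Suc m) b"
  proof
    fix z assume "z \<in> (*) (\<iota> (p ^ Suc m)) ` ord 0"
    then obtain x y where xy: "x \<in> \<O>" "y \<in> \<O>" "z = \<iota> (p ^ Suc m) * quad x y"
      by (auto simp: quad_order_eq)
    have "p ^ Suc m * y - p ^ Suc m * x * b = p ^ Suc m * (y - x * b)" by (simp add: algebra_simps)
    moreover have "y - x * b \<in> \<O>" "p ^ Suc m * x \<in> \<O>" using xy b by blast+
    ultimately have "z \<in> branch (Suc m) b" unfolding xy quad_scale quad_mem_branch[OF b] by blast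
    then show "z \<in> (*) (\<iota> 1) ` branch (Suc m) b" by simp
  qed
  moreover have "(*) (\<iota> 1) ` branch (Suc m) b \<subseteq> ord 0"
  proof
    fix z assume "z \<in> (*) (\<iota> 1) ` branch (Suc m) b"
    then have z: "z \<in> branch (Suc m) b" by simp
    obtain a e where ae: "z = quad a e" by (rule quad_exists)
    then obtain f where f: "a \<in> \<O>" "f \<in> \<O>" "e - a * b = p ^ Suc m * f"
      using z quad_mem_branch[OF b] by auto
    then have "e = a * b + p ^ Suc m * f" by (simp add: algebra_simps)
    then have "e \<in> \<O>" using f b by blast
    then show "z \<in> ord 0" using f by (simp add: ae quad_mem_order_zero)
  qed
  ultimately show "lat_within (Suc m) (branch (Suc m) b) (ord 0)"
    unfolding lat_within_def by (intro exI[of _ 1]) simp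
  have pm: "quad 0 (p ^ m) = \<iota> (p ^ m) * quad 0 1" by (simp add: quad_scale)
  have mem: "quad 0 1 \<in> ord 0" "quad 0 1 \<in> (*) \<pi> ` ord 0"
    by (auto simp: quad_mem_order_zero quad_mem_pi_order intro: bexI[of _ 0])
  show "\<not> lat_within m (branch (Suc m) b) (ord 0)"
    unfolding lat_within_def using branch_not_within[OF b] mem pm by blast
  show "\<not> lat_within m (branch (Suc m) b) ((*) \<pi> ` ord 0)"
  proof
    assume "lat_within m (branch (Suc m) b) ((*) \<pi> ` ord 0)"
    then obtain c where c: "c \<noteq> 0"
      "(*) (\<iota> (p ^ m)) ` (*) \<pi> ` ord 0 \<subseteq> (*) (\<iota> c) ` branch (Suc m) b"
      "(*) (\<iota> c) ` branch (Suc m) b \<subseteq> (*) \<pi> ` ord 0"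
      unfolding lat_within_def by blast
    have "quad 0 (p ^ m) \<in> (*) (\<iota> (p ^ m)) ` (*) \<pi> ` ord 0" unfolding pm using mem(2) by (rule imageI)
    from subsetD[OF c(2) this] show False
      using order_trans[OF c(3) pi_order_subset] by (rule branch_not_within[OF b c(1)])
  qed
qed

text \<open>A representative \<open>L\<close> between \<open>p ^ Suc m\<close> times
  \<open>ord 0\<close> and \<open>ord 0\<close> must contain some \<open>1 + b \<pi>\<close>, as
  otherwise it would be within \<open>m\<close> of one of the base lattices. Failure of the bound
  \<open>m\<close> at \<open>ord 0\<close> then leaves no room for anything beyond the branch of
  \<open>b\<close>.\<close>

lemma outward_imp_branch:
  assumes lat: "lattice \<Lambda>" and out: "outward m \<Lambda>"
  shows "\<exists>b\<in>\<O>. cls \<Lambda> = cls (branch (Suc m) b)"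
proof -
  obtain c where c: "c \<noteq> 0" and lower: "(*) (\<iota> (p ^ Suc m)) ` ord 0 \<subseteq> (*) (\<iota> c) ` \<Lambda>"
    and upper: "(*) (\<iota> c) ` \<Lambda> \<subseteq> ord 0"
    using out unfolding lat_within_def by blast
  define L where "L = (*) (\<iota> c) ` \<Lambda>"
  have latL: "lattice L" unfolding L_def using lat c by (simp add: lattice_times)
  have clsL: "cls L = cls \<Lambda>" unfolding L_def using c by (rule cls_times)
  have scale: "quad (s * x) (s * y) \<in> L" if "quad x y \<in> L" "s \<in> \<O>" for s x y
    using lattice_scale[OF latL that(2,1)] by (simp add: quad_scale)
  have diff: "quad (x - x') (y - y') \<in> L" if "quad x y \<in> L" "quad x' y' \<in> L" for x y x' y'
    using lattice_diff[OF latL that] by (simp add: quad_diff)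
  have add: "quad (x + x') (y + y') \<in> L" if "quad x y \<in> L" "quad x' y' \<in> L" for x y x' y'
    using lattice_add[OF latL that] by (simp add: quad_add)
  have lowerL: "quad (p ^ Suc m * x) (p ^ Suc m * y) \<in> L" if "x \<in> \<O>" "y \<in> \<O>" for x y
  proof -
    have "quad x y \<in> ord 0" using that by (simp add: quad_mem_order_zero)
    then have "\<iota> (p ^ Suc m) * quad x y \<in> L" using lower unfolding L_def by blast
    then show ?thesis by (simp only: quad_scale)
  qed
  have upperL: "x \<in> \<O> \<and> y \<in> \<O>" if "quad x y \<in> L" for x y
    using that upper unfolding L_def by (metis quad_mem_order_zero subsetD)
  have not_within: "\<not> lat_within m L (ord 0)" "\<not> lat_within m L ((*) \<pi> ` ord 0)"
    using out lat_within_cong[OF latL lat lattice_order lattice_order clsL refl]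
      lat_within_cong[OF latL lat lattice_times lattice_times clsL refl] lattice_order pi_nonzero
    by blast+
  have not_order: "\<not> (*) (\<iota> (p ^ m)) ` ord 0 \<subseteq> L"
  proof
    assume "(*) (\<iota> (p ^ m)) ` ord 0 \<subseteq> L"
    then have "lat_within m L (ord 0)"
      unfolding lat_within_def using upper by (intro exI[of _ 1]) (simp add: L_def)
    then show False using not_within by simp
  qed
  have corner: "\<not> (quad (p ^ m) 0 \<in> L \<and> quad 0 (p ^ m) \<in> L)"
  proof
    assume asm: "quad (p ^ m) 0 \<in> L \<and> quad 0 (p ^ m) \<in> L"
    have "\<iota> (p ^ m) * quad x y \<in> L" if "x \<in> \<O>" "y \<in> \<O>" for x y
    proof -
      have "quad (x * p ^ m + y * 0) (x * 0 + y * p ^ m) \<in> L" using asm that by (intro add scale) auto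
      then show ?thesis by (simp add: quad_scale mult.commute)
    qed
    then show False using not_order by (auto simp: quad_order_eq)
  qed
  have "\<exists>b. quad 1 b \<in> L"
  proof (rule ccontr)
    assume no: "\<nexists>b. quad 1 b \<in> L"
    \<comment> \<open>An element with unit first coordinate could be rescaled to the form
      \<open>1 + b \<pi>\<close>.\<close>
    have first: "\<exists>f\<in>\<O>. x = p * f" if xy: "quad x y \<in> L" for x y
    proof -
      have "x \<in> \<O>" using upperL[OF xy] by simp
      then show ?thesis
      proof (cases rule: O_cases)
        case unit
        then have "quad 1 (inverse x * y) \<in> L" using scale[OF xy, of "inverse x"] by simp
        then show ?thesis using no by blast
      qed blast
    qed
    have L_pi: "L \<subseteq> (*) \<pi> ` ord 0"
    proof
      fix z assume z: "z \<in> L"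
      obtain x y where xy: "z = quad x y" by (rule quad_exists)
      then show "z \<in> (*) \<pi> ` ord 0" using first upperL z by (simp add: quad_mem_pi_order)
    qed
    \<comment> \<open>If all second coordinates were multiples of \<open>p\<close> too, dividing
      \<open>L\<close> by \<open>p\<close> would show it to be within \<open>m\<close> of
      \<open>ord 0\<close>.\<close>
    have "\<exists>x y. quad x y \<in> L \<and> \<not> (\<exists>f\<in>\<O>. y = p * f)"
    proof (rule ccontr)
      assume "\<not> ?thesis"
      then have second: "\<exists>f\<in>\<O>. y = p * f" if "quad x y \<in> L" for x y using that by blast
      have "L \<subseteq> (*) (\<iota> p) ` ord 0"
      proof
        fix z assume z: "z \<in> L"
        obtain x y where xy: "z = quad x y" by (rule quad_exists)
        obtain f where f: "f \<in> \<O>" "x = p * f" using first z xy by blast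
        obtain g where g: "g \<in> \<O>" "y = p * g" using second z xy by blast
        have "z = \<iota> p * quad f g" by (simp add: xy f g quad_scale)
        moreover have "quad f g \<in> ord 0" using f g by (simp add: quad_mem_order_zero)
        ultimately show "z \<in> (*) (\<iota> p) ` ord 0" by blast
      qed
      then have "(*) (\<iota> (inverse p)) ` L \<subseteq> (*) (\<iota> (inverse p)) ` (*) (\<iota> p) ` ord 0"
        by (rule image_mono)
      then have "(*) (\<iota> (inverse p)) ` L \<subseteq> ord 0" by (simp flip: emb_mult)
      moreover have "(*) (\<iota> (inverse p)) ` (*) (\<iota> (p ^ Suc m)) ` ord 0 \<subseteq> (*) (\<iota> (inverse p)) ` L"
        using lower unfolding L_def by (rule image_mono)
      then have "(*) (\<iota> (p ^ m)) ` ord 0 \<subseteq> (*) (\<iota> (inverse p)) ` L"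
        by (simp flip: emb_mult mult.assoc)
      ultimately have "lat_within m L (ord 0)"
        unfolding lat_within_def by (intro exI[of _ "inverse p"]) simp
      then show False using not_within by simp
    qed
    then obtain x y where xy: "quad x y \<in> L" and y: "\<not> (\<exists>f\<in>\<O>. y = p * f)" by blast
    have "y \<in> \<O>" using upperL[OF xy] by simp
    then have yu: "y \<noteq> 0" "inverse y \<in> \<O>" using y by (cases rule: O_cases; blast)+
    obtain f where f: "f \<in> \<O>" "x = p * f" using first[OF xy] by blast
    \<comment> \<open>Scaling makes the second coordinate \<open>p ^ m\<close>; the first is then a
      multiple of \<open>p ^ Suc m\<close> and is removed by an element of \<open>p ^ Suc m\<close>
      times \<open>ord 0\<close>.\<close>
    have "quad (p ^ m * inverse y * x - p ^ Suc m * (inverse y * f))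
        (p ^ m * inverse y * y - p ^ Suc m * 0) \<in> L"
      using yu f(1) by (intro diff scale xy lowerL) blast+
    moreover have "p ^ m * inverse y * x - p ^ Suc m * (inverse y * f) = 0"
      by (simp add: f(2) algebra_simps)
    moreover have "p ^ m * inverse y * y - p ^ Suc m * 0 = p ^ m" using yu by simp
    ultimately have pm: "quad 0 (p ^ m) \<in> L" by (simp only:)
    have pi_L: "\<iota> (p ^ m) * quad (p * s) t \<in> L" if "s \<in> \<O>" "t \<in> \<O>" for s t
    proof -
      have "quad (p ^ Suc m * s + t * 0) (p ^ Suc m * 0 + t * p ^ m) \<in> L"
        using that by (intro add lowerL scale pm) auto
      then show ?thesis by (simp add: quad_scale algebra_simps)
    qed
    have "(*) (\<iota> (p ^ m)) ` (*) \<pi> ` ord 0 \<subseteq> L"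
    proof
      fix z assume "z \<in> (*) (\<iota> (p ^ m)) ` (*) \<pi> ` ord 0"
      then obtain y where y: "y \<in> (*) \<pi> ` ord 0" "z = \<iota> (p ^ m) * y" by (rule imageE)
      obtain a b where "y = quad a b" by (rule quad_exists)
      then show "z \<in> L" using y pi_L by (auto simp: quad_mem_pi_order)
    qed
    then have "lat_within m L ((*) \<pi> ` ord 0)"
      unfolding lat_within_def using L_pi by (intro exI[of _ 1]) simp
    then show False using not_within by simp
  qed
  then obtain b where bL: "quad 1 b \<in> L" by blast
  then have b: "b \<in> \<O>" using upperL by blast
  have "L = branch (Suc m) b"
  proof (intro equalityI subsetI)
    fix z assume z: "z \<in> L"
    obtain x y where xy: "z = quad x y" by (rule quad_exists)
    have x: "x \<in> \<O>" using upperL z xy by blast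
    have "quad (x - x * 1) (y - x * b) \<in> L" using z xy x bL by (intro diff scale) auto
    then have res: "quad 0 (y - x * b) \<in> L" by simp
    show "z \<in> branch (Suc m) b"
    \<comment> \<open>Subtracting \<open>x (1 + b \<pi>)\<close> leaves a multiple of \<pi>. Were it
      not divisible by \<open>p ^ Suc m\<close>, then \<open>p ^ m \<pi>\<close> and, by means of
      \<open>1 + b \<pi>\<close>, also \<open>p ^ m\<close> would lie in \<open>L\<close>, against
      \<open>corner\<close>.\<close>
    proof (cases rule: power_p_dvd_cases[where x = "y - x * b" and n = m])
      case (multiple f)
      then show ?thesis using x by (auto simp: xy quad_mem_branch[OF b])
    next
      case (divisor f)
      have "quad (f * 0) (f * (y - x * b)) \<in> L" using divisor by (intro scale res)
      then have pm: "quad 0 (p ^ m) \<in> L" using divisor by (simp add: mult.commute)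
      have "quad (p ^ m * 1 - b * 0) (p ^ m * b - b * p ^ m) \<in> L"
        using b by (intro diff scale bL pm) auto
      then have "quad (p ^ m) 0 \<in> L" by (simp add: mult.commute)
      then show ?thesis using corner pm by blast
    qed
  next
    fix z assume z: "z \<in> branch (Suc m) b"
    obtain x y where xy: "z = quad x y" by (rule quad_exists)
    then obtain f where f: "x \<in> \<O>" "f \<in> \<O>" "y - x * b = p ^ Suc m * f"
      using z quad_mem_branch[OF b] by auto
    have "quad (x * 1 + p ^ Suc m * 0) (x * b + p ^ Suc m * f) \<in> L"
      using f by (intro add scale bL lowerL) auto
    moreover have "x * b + p ^ Suc m * f = y" using f(3) by (simp add: algebra_simps)
    ultimately show "z \<in> L" by (simp add: xy)
  qed
  then show ?thesis using b clsL by auto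
qed

section \<open>The edge between the two base vertices\<close>

lemma p_order_psubset: "(*) (\<iota> p) ` ord 0 \<subset> (*) \<pi> ` ord 0"
proof (rule psubsetI)
  show "(*) (\<iota> p) ` ord 0 \<subseteq> (*) \<pi> ` ord 0"
    unfolding pi_pi_order[symmetric] using pi_order_subset by (rule image_mono)
  have "quad 0 1 \<in> (*) \<pi> ` ord 0" by (auto simp: quad_mem_pi_order intro: bexI[of _ 0])
  moreover have "quad 0 1 \<notin> (*) (\<iota> p) ` ord 0"
  proof
    assume "quad 0 1 \<in> (*) (\<iota> p) ` ord 0"
    then obtain x y where "y \<in> \<O>" "quad 0 1 = \<iota> p * quad x y" by (auto simp: quad_order_eq)
    then show False using p_mult_ne_one[of y] by (simp add: quad_scale quad_eq_iff)
  qed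
  ultimately show "(*) (\<iota> p) ` ord 0 \<noteq> (*) \<pi> ` ord 0" by blast
qed

lemma pi_order_psubset: "(*) \<pi> ` ord 0 \<subset> ord 0"
proof (rule psubsetI[OF pi_order_subset])
  have "quad 1 0 \<in> ord 0" by (simp add: quad_mem_order_zero)
  moreover have "quad 1 0 \<notin> (*) \<pi> ` ord 0" by (auto simp: quad_mem_pi_order dest: p_mult_ne_one)
  ultimately show "(*) \<pi> ` ord 0 \<noteq> ord 0" by blast
qed

lemma lattice_pi_order: "lattice ((*) \<pi> ` ord 0)"
  by (intro lattice_times lattice_order pi_nonzero)

lemma base_arcs:
  "(cls (ord 0), cls ((*) \<pi> ` ord 0)) \<in> arcs T" "(cls ((*) \<pi> ` ord 0), cls (ord 0)) \<in> arcs T"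
  by (rule arcI[OF lattice_pi_order lattice_order p_order_psubset pi_order_psubset])
    (rule arcI'[OF lattice_pi_order lattice_order p_order_psubset pi_order_psubset])

text \<open>If \<pi> times \<open>ord 0\<close> were \<open>c\<close> times \<open>ord 0\<close>,
  its element \<open>c\<close> would be a multiple of \<open>p\<close>, whereas its element \<pi>
  would make \<open>c\<close> invertible.\<close>

lemma cls_pi_order_ne: "cls ((*) \<pi> ` ord 0) \<noteq> cls (ord 0)"
proof
  assume "cls ((*) \<pi> ` ord 0) = cls (ord 0)"
  then obtain c where eq: "(*) \<pi> ` ord 0 = (*) (\<iota> c) ` ord 0" by (rule cls_eqD)
  have "quad 1 0 \<in> ord 0" by (simp add: quad_mem_order_zero)
  then have "\<iota> c * quad 1 0 \<in> (*) \<pi> ` ord 0" unfolding eq by (rule imageI)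
  then obtain f where f: "f \<in> \<O>" "c = p * f" by (auto simp: quad_scale quad_mem_pi_order)
  have "quad 0 1 \<in> (*) \<pi> ` ord 0" by (auto simp: quad_mem_pi_order intro: bexI[of _ 0])
  then have "quad 0 1 \<in> (*) (\<iota> c) ` ord 0" by (simp only: eq)
  then obtain x y where "y \<in> \<O>" "quad 0 1 = \<iota> c * quad x y" by (auto simp: quad_order_eq)
  then have "p * (f * y) = 1" "f * y \<in> \<O>" using f by (auto simp: quad_scale quad_eq_iff mult.assoc)
  then show False using p_mult_ne_one by blast
qed

section \<open>The two spheres\<close>

lemma outward_iff:
  assumes "lattice \<Lambda>"
  shows "outward m \<Lambda> \<longleftrightarrow> (\<exists>b\<in>\<O>. cls \<Lambda> = cls (branch (Suc m) b))"
proof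
  assume "\<exists>b\<in>\<O>. cls \<Lambda> = cls (branch (Suc m) b)"
  then obtain b where b: "b \<in> \<O>" "cls \<Lambda> = cls (branch (Suc m) b)" by blast
  show "outward m \<Lambda>"
    using outward_branch[OF b(1), of m] lat_within_cong[OF assms lattice_branch _ _ b(2) refl]
      lattice_order lattice_pi_order by blast
qed (rule outward_imp_branch[OF assms])

lemma sphere_at_order:
  "{x \<in> verts T. graph_dist T x (cls (ord 0)) = ereal (real (Suc m)) \<and>
      geodesic_avoids T x (cls (ord 0)) (cls ((*) \<pi> ` ord 0))} =
   {cls (branch (Suc m) b) | b. b \<in> \<O>}" (is "?S = ?R")
proof -
  have mem: "cls \<Lambda> \<in> ?S \<longleftrightarrow> cls \<Lambda> \<in> ?R" if lat: "lattice \<Lambda>" for \<Lambda>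
  proof -
    have "cls \<Lambda> \<in> ?S \<longleftrightarrow> outward m \<Lambda>"
      using geodesic_avoids_iff_lat_within
          [OF lat lattice_order lattice_pi_order base_arcs(2) cls_pi_order_ne, of m]
        cls_in_verts[OF lat] by blast
    also have "\<dots> \<longleftrightarrow> (\<exists>b\<in>\<O>. cls \<Lambda> = cls (branch (Suc m) b))" by (rule outward_iff[OF lat])
    finally show ?thesis by blast
  qed
  have "?S \<subseteq> verts T" "?R \<subseteq> verts T" using lattice_branch cls_in_verts by blast+
  then show ?thesis using mem by (rule vertex_sets_eqI)
qed

lemma sphere_at_pi_order:
  "{x \<in> verts T. graph_dist T x (cls ((*) \<pi> ` ord 0)) = ereal (real (Suc m)) \<and>
      geodesic_avoids T x (cls ((*) \<pi> ` ord 0)) (cls (ord 0))} =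
   {cls ((*) \<pi> ` branch (Suc m) b) | b. b \<in> \<O>}" (is "?S = ?R")
proof -
  have mem: "cls \<Lambda> \<in> ?S \<longleftrightarrow> cls \<Lambda> \<in> ?R" if lat: "lattice \<Lambda>" for \<Lambda>
  proof -
    define L where "L = (*) (inverse \<pi>) ` \<Lambda>"
    have \<Lambda>: "\<Lambda> = (*) \<pi> ` L" using pi_nonzero by (simp add: L_def)
    have latL: "lattice L" unfolding L_def using lat pi_nonzero by (intro lattice_times) auto
    \<comment> \<open>Replacing \<open>ord 0\<close> by its homothetic copy gives both reference
      lattices a factor \<pi>, which cancels against the one in \<Lambda> and reduces the claim to
      \<open>outward m L\<close>.\<close>
    have "cls (ord 0) = cls ((*) \<pi> ` (*) \<pi> ` ord 0)"
      by (simp only: pi_pi_order cls_times[OF p_nonzero])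
    then have swap: "lat_within k \<Lambda> (ord 0) \<longleftrightarrow> lat_within k \<Lambda> ((*) \<pi> ` (*) \<pi> ` ord 0)" for k
      by (intro lat_within_cong lat lattice_order lattice_times lattice_pi_order pi_nonzero refl)
    have "cls \<Lambda> \<in> ?S \<longleftrightarrow> outward m L"
      using geodesic_avoids_iff_lat_within
          [OF lat lattice_pi_order lattice_order base_arcs(1) cls_pi_order_ne[symmetric], of m]
        cls_in_verts[OF lat]
      unfolding swap unfolding \<Lambda> lat_within_times[OF pi_nonzero] by blast
    also have "\<dots> \<longleftrightarrow> (\<exists>b\<in>\<O>. cls L = cls (branch (Suc m) b))" by (rule outward_iff[OF latL])
    also have "\<dots> \<longleftrightarrow> (\<exists>b\<in>\<O>. cls \<Lambda> = cls ((*) \<pi> ` branch (Suc m) b))"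
    proof -
      have "cls L = cls N \<longleftrightarrow> cls \<Lambda> = cls ((*) \<pi> ` N)" for N
      proof
        assume "cls L = cls N"
        then show "cls \<Lambda> = cls ((*) \<pi> ` N)" unfolding \<Lambda> by (rule cls_times_cong)
      next
        assume "cls \<Lambda> = cls ((*) \<pi> ` N)"
        then have "cls ((*) (inverse \<pi>) ` \<Lambda>) = cls ((*) (inverse \<pi>) ` (*) \<pi> ` N)"
          by (rule cls_times_cong)
        then show "cls L = cls N" using pi_nonzero by (simp add: L_def)
      qed
      then show ?thesis by (simp only:)
    qed
    finally show ?thesis by blast
  qed
  have "?S \<subseteq> verts T" "?R \<subseteq> verts T"
    using lattice_branch cls_in_verts lattice_times pi_nonzero by blast+
  then show ?thesis using mem by (rule vertex_sets_eqI)
qed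

section \<open>The products of the units\<close>

lemma unit_prod_Suc: "unit_prod \<iota> p \<pi> (Suc n) \<alpha> = unit_prod \<iota> p \<pi> n \<alpha> * quad 1 (\<alpha> n * p ^ n)"
  by (simp add: unit_prod_def quad_def)

text \<open>The product of \<open>1 + b \<pi>\<close> and \<open>1 + s \<pi>\<close> has first
  coordinate \<open>1 - b s \<delta>\<close>, a unit of the base ring; it is pulled out as the
  scalar \<open>d\<close>.\<close>

lemma unit_prod_shape:
  assumes "\<forall>i<n. \<alpha> i \<in> \<O>"
  shows "\<exists>c b. unit c \<and> b \<in> \<O> \<and> unit_prod \<iota> p \<pi> n \<alpha> = \<iota> c * quad 1 b"
  using assms
proof (induct n)
  case 0
  have "unit_prod \<iota> p \<pi> 0 \<alpha> = \<iota> 1 * quad 1 0" by (simp add: unit_prod_def quad_def)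
  then show ?case using unit_one O_zero by blast
next
  case (Suc n)
  then obtain c b where cb: "unit c" "b \<in> \<O>" "unit_prod \<iota> p \<pi> n \<alpha> = \<iota> c * quad 1 b" by auto
  define s where "s = \<alpha> n * p ^ n"
  define d where "d = 1 + (- b * s) * \<delta>"
  have s: "s \<in> \<O>" using Suc.prems by (auto simp: s_def)
  have d: "unit d" unfolding d_def using cb s by (intro unit_add_delta unit_one) blast
  have "d * (inverse d * x) = x" for x using unitD(2)[OF d] by (simp flip: mult.assoc)
  then have "quad 1 b * quad 1 s = \<iota> d * quad 1 (inverse d * (b + s + b * s * \<tau>))"
    unfolding quad_mult quad_scale quad_eq_iff by (simp only:) (simp add: d_def)
  then have "unit_prod \<iota> p \<pi> (Suc n) \<alpha> = \<iota> (c * d) * quad 1 (inverse d * (b + s + b * s * \<tau>))"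
    by (simp add: unit_prod_Suc cb emb_mult mult.assoc flip: s_def)
  moreover have "unit (c * d)" using cb d by (intro unit_mult)
  moreover have "inverse d * (b + s + b * s * \<tau>) \<in> \<O>" using cb s unitD[OF d] by blast
  ultimately show ?case by blast
qed

text \<open>Successive approximation: having matched \<open>1 + b\<pi>\<close> up to a unit of \<open>\<O>\<^sub>n\<close>, the next
  digit \<open>t\<close> is forced to be the residue of \<open>d / c\<close>.\<close>

lemma unit_prod_exhausts:
  assumes R: "residue_reps v p R" and b: "b \<in> \<O>"
  shows "\<exists>\<alpha> \<in> {..<n} \<rightarrow>\<^sub>E R. \<exists>c d. unit c \<and> d \<in> \<O> \<and>
    quad 1 b = unit_prod \<iota> p \<pi> n \<alpha> * quad c (p ^ n * d)"
proof (induct n)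
  case 0
  \<comment> \<open>The constant \<open>undefined\<close> is the only extensional function on the
    empty index set, and the empty product is 1.\<close>
  have "quad 1 b = unit_prod \<iota> p \<pi> 0 (\<lambda>_. undefined) * quad 1 (p ^ 0 * b)"
    by (simp add: unit_prod_def)
  moreover have "(\<lambda>_. undefined) \<in> {..<0::nat} \<rightarrow>\<^sub>E R" by simp
  ultimately show ?case using b unit_one by blast
next
  case (Suc n)
  then obtain \<alpha> c d where \<alpha>: "\<alpha> \<in> {..<n} \<rightarrow>\<^sub>E R" and c: "unit c" and d: "d \<in> \<O>"
    and eq: "quad 1 b = unit_prod \<iota> p \<pi> n \<alpha> * quad c (p ^ n * d)" by blast
  note cO = unitD[OF c]
  have "inverse c * d \<in> \<O>" using cO d by blast
  then obtain t g where t: "t \<in> R" "t \<in> \<O>" and g: "g \<in> \<O>" "inverse c * d - t = p * g"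
    using R unfolding residue_reps_def by blast
  define s where "s = t * p ^ n"
  define N where "N = 1 + s * \<tau> + s * s * \<delta>"
  \<comment> \<open>Found by comparing coordinates in
    \<open>(1 + s \<pi>) (c' + p ^ Suc n d' \<pi>) = c + p ^ n d \<pi>\<close>: the first gives
    \<open>c'\<close>, and after its substitution the second becomes \<open>d' N = c g\<close>, with
    \<open>N\<close> the norm of \<open>1 + s \<pi>\<close>.\<close>
  define d' where "d' = c * g * inverse N"
  define c' where "c' = c + (s * (p ^ Suc n * d')) * \<delta>"
  have s: "s \<in> \<O>" using t by (auto simp: s_def)
  have N: "unit N" unfolding N_def using s by (rule unit_norm)
  have d': "d' \<in> \<O>" unfolding d'_def using cO g unitD[OF N] by blast
  have c': "unit c'" unfolding c'_def using c s d' by (intro unit_add_delta) blast+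
  have "c * (inverse c * d) = c * (t + p * g)" using g(2) by (simp add: algebra_simps)
  then have dt: "d = c * (t + p * g)" using cO by (simp flip: mult.assoc)
  have d'N: "d' * N = c * g" using unitD[OF N] by (simp add: d'_def mult.assoc)
  have "s * c' + p ^ Suc n * d' + s * (p ^ Suc n * d') * \<tau> = s * c + p ^ Suc n * (d' * N)"
    by (simp add: c'_def N_def algebra_simps)
  also have "\<dots> = p ^ n * d" unfolding d'N by (simp add: s_def dt algebra_simps)
  finally have "quad 1 s * quad c' (p ^ Suc n * d') = quad c (p ^ n * d)"
    unfolding quad_mult quad_eq_iff by (simp add: c'_def algebra_simps)
  moreover define \<beta> where "\<beta> = \<alpha>(n := t)"
  have "unit_prod \<iota> p \<pi> (Suc n) \<beta> = unit_prod \<iota> p \<pi> n \<alpha> * quad 1 s"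
  proof -
    have "unit_prod \<iota> p \<pi> n \<beta> = unit_prod \<iota> p \<pi> n \<alpha>"
      unfolding unit_prod_def by (intro prod.cong) (auto simp: \<beta>_def)
    then show ?thesis by (simp add: unit_prod_Suc s_def \<beta>_def)
  qed
  ultimately have "quad 1 b = unit_prod \<iota> p \<pi> (Suc n) \<beta> * quad c' (p ^ Suc n * d')"
    by (simp only: eq mult.assoc)
  moreover have "\<beta> \<in> {..<Suc n} \<rightarrow>\<^sub>E R"
    unfolding \<beta>_def lessThan_Suc using t(1) \<alpha> by (rule PiE_fun_upd)
  ultimately show ?case using c' d' by blast
qed

text \<open>A unit scalar does not change the class, which gives one direction. For the other, the
  factorization of \<open>1 + b \<pi>\<close> places it in the branch of \<open>u_\<alpha>\<close>,
  and \<open>branch_cong\<close> turns this single membership into equality.\<close>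

lemma unit_prod_classes:
  assumes R: "residue_reps v p R"
  shows "\<And>\<alpha>. \<alpha> \<in> {..<n} \<rightarrow>\<^sub>E R \<Longrightarrow>
      \<exists>b\<in>\<O>. cls ((*) (unit_prod \<iota> p \<pi> n \<alpha>) ` ord n) = cls (branch n b)"
    and "\<And>b. b \<in> \<O> \<Longrightarrow>
      \<exists>\<alpha>\<in>{..<n} \<rightarrow>\<^sub>E R. cls (branch n b) = cls ((*) (unit_prod \<iota> p \<pi> n \<alpha>) ` ord n)"
proof -
  have shape: "\<exists>b c. unit c \<and> b \<in> \<O> \<and> unit_prod \<iota> p \<pi> n \<alpha> = \<iota> c * quad 1 b \<and>
      cls ((*) (unit_prod \<iota> p \<pi> n \<alpha>) ` ord n) = cls (branch n b)"
    if \<alpha>: "\<alpha> \<in> {..<n} \<rightarrow>\<^sub>E R" for \<alpha>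
  proof -
    have "\<forall>i<n. \<alpha> i \<in> \<O>" using \<alpha> R by (auto simp: residue_reps_def PiE_iff)
    then obtain c b where cb: "unit c" "b \<in> \<O>" "unit_prod \<iota> p \<pi> n \<alpha> = \<iota> c * quad 1 b"
      using unit_prod_shape by blast
    have "(*) (unit_prod \<iota> p \<pi> n \<alpha>) ` ord n = (*) (\<iota> c) ` branch n b" by (simp add: cb)
    then show ?thesis using cb cls_times[OF unitD(2)[OF cb(1)]] by metis
  qed
  show "\<exists>b\<in>\<O>. cls ((*) (unit_prod \<iota> p \<pi> n \<alpha>) ` ord n) = cls (branch n b)"
    if "\<alpha> \<in> {..<n} \<rightarrow>\<^sub>E R" for \<alpha>
    using shape[OF that] by blast
  show "\<exists>\<alpha>\<in>{..<n} \<rightarrow>\<^sub>E R. cls (branch n b) = cls ((*) (unit_prod \<iota> p \<pi> n \<alpha>) ` ord n)"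
    if b: "b \<in> \<O>" for b
  proof -
    obtain \<alpha> c d where \<alpha>: "\<alpha> \<in> {..<n} \<rightarrow>\<^sub>E R" and c: "unit c" and d: "d \<in> \<O>"
      and eq: "quad 1 b = unit_prod \<iota> p \<pi> n \<alpha> * quad c (p ^ n * d)"
      using unit_prod_exhausts[OF R b, of n] by blast
    obtain b' c' where b': "unit c'" "b' \<in> \<O>" "unit_prod \<iota> p \<pi> n \<alpha> = \<iota> c' * quad 1 b'"
      "cls ((*) (unit_prod \<iota> p \<pi> n \<alpha>) ` ord n) = cls (branch n b')"
      using shape[OF \<alpha>] by blast
    have "quad c (p ^ n * d) \<in> ord n" using unitD(1)[OF c] d by (auto simp: quad_mem_order)
    then have "\<iota> c' * quad c (p ^ n * d) \<in> ord n"
      using unitD(1)[OF b'(1)] lattice_scale[OF lattice_order] by blast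
    \<comment> \<open>The scalar \<open>c'\<close> moves from the product into the factor from the
      order, which is stable under integral scalars.\<close>
    moreover have "quad 1 b = quad 1 b' * (\<iota> c' * quad c (p ^ n * d))"
      unfolding eq b'(3) by (simp only: mult_ac)
    ultimately have "quad 1 b \<in> branch n b'" by blast
    then have "branch n b = branch n b'" using b b'(2) by (intro branch_cong)
    then show ?thesis using \<alpha> b'(4) by metis
  qed
qed

end

theorem theorem5p16:
  fixes v :: "'k::field_char_0 \<Rightarrow> int" and w :: "'l::field \<Rightarrow> int"
    and \<iota> :: "'k \<Rightarrow> 'l" and p \<tau> \<delta> :: 'k and \<pi> :: 'l and R :: "'k set" and n :: nat
  assumes "nonarch_local_field v" and "uniformizer v p"
    and "ramified_quadratic_ext \<iota> v w" and "uniformizer w \<pi>"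
    and "is_min_poly \<iota> [:\<delta>, - \<tau>, 1:] \<pi>"
    and "val_ge v 1 \<tau>" and "\<delta> \<noteq> 0" and "v \<delta> = 1"
    and "residue_reps v p R"
    and "n \<ge> 1"
  shows "{homothety_class \<iota> ((*) (unit_prod \<iota> p \<pi> n \<alpha>) ` quad_order \<iota> v p \<pi> n) | \<alpha>.
             \<alpha> \<in> {..<n} \<rightarrow>\<^sub>E R} =
           {x \<in> verts (bruhat_tits_tree \<iota> v p).
             graph_dist (bruhat_tits_tree \<iota> v p) x
               (homothety_class \<iota> (quad_order \<iota> v p \<pi> 0)) = ereal (real n) \<and>
             geodesic_avoids (bruhat_tits_tree \<iota> v p) x
               (homothety_class \<iota> (quad_order \<iota> v p \<pi> 0))
               (homothety_class \<iota> ((*) \<pi> ` quad_order \<iota> v p \<pi> 0))} \<and>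
         {homothety_class \<iota> ((*) (unit_prod \<iota> p \<pi> n \<alpha> * \<pi>) ` quad_order \<iota> v p \<pi> n) | \<alpha>.
             \<alpha> \<in> {..<n} \<rightarrow>\<^sub>E R} =
           {x \<in> verts (bruhat_tits_tree \<iota> v p).
             graph_dist (bruhat_tits_tree \<iota> v p) x
               (homothety_class \<iota> ((*) \<pi> ` quad_order \<iota> v p \<pi> 0)) = ereal (real n) \<and>
             geodesic_avoids (bruhat_tits_tree \<iota> v p) x
               (homothety_class \<iota> ((*) \<pi> ` quad_order \<iota> v p \<pi> 0))
               (homothety_class \<iota> (quad_order \<iota> v p \<pi> 0))}"
proof -
  interpret ramified_quadratic v p \<iota> \<pi> \<tau> \<delta>
    using assms
    by unfold_locales (auto simp: nonarch_local_field_def ramified_quadratic_ext_def)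
  \<comment> \<open>The sphere lemmas have radius \<open>Suc m\<close>.\<close>
  obtain m where n: "n = Suc m" using assms(10) by (cases n) auto
  note classes = unit_prod_classes[OF assms(9), where n = n]
  have twist: "(*) (u * \<pi>) ` S = (*) \<pi> ` (*) u ` S" for u and S :: "'l set"
    by (simp only: times_image_times mult.commute[of \<pi>])
  have "{cls ((*) (unit_prod \<iota> p \<pi> n \<alpha>) ` ord n) | \<alpha>. \<alpha> \<in> {..<n} \<rightarrow>\<^sub>E R} =
      {cls (branch n b) | b. b \<in> \<O>}"
    by (rule Collect_image_eqI) (fact classes)+
  moreover have "{cls ((*) (unit_prod \<iota> p \<pi> n \<alpha> * \<pi>) ` ord n) | \<alpha>. \<alpha> \<in> {..<n} \<rightarrow>\<^sub>E R} =
      {cls ((*) \<pi> ` branch n b) | b. b \<in> \<O>}"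
    unfolding twist
  proof (rule Collect_image_eqI)
    fix \<alpha> assume "\<alpha> \<in> {..<n} \<rightarrow>\<^sub>E R"
    then obtain b where "b \<in> \<O>" "cls ((*) (unit_prod \<iota> p \<pi> n \<alpha>) ` ord n) = cls (branch n b)"
      using classes(1) by blast
    then show "\<exists>b\<in>\<O>. cls ((*) \<pi> ` (*) (unit_prod \<iota> p \<pi> n \<alpha>) ` ord n) = cls ((*) \<pi> ` branch n b)"
      by (intro bexI[of _ b] cls_times_cong)
  next
    fix b assume "b \<in> \<O>"
    then obtain \<alpha> where "\<alpha> \<in> {..<n} \<rightarrow>\<^sub>E R"
      "cls (branch n b) = cls ((*) (unit_prod \<iota> p \<pi> n \<alpha>) ` ord n)"
      using classes(2) by blast
    then show "\<exists>\<alpha>\<in>{..<n} \<rightarrow>\<^sub>E R.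
        cls ((*) \<pi> ` branch n b) = cls ((*) \<pi> ` (*) (unit_prod \<iota> p \<pi> n \<alpha>) ` ord n)"
      by (intro bexI[of _ \<alpha>] cls_times_cong)
  qed
  ultimately show ?thesis
    using sphere_at_order[of m] sphere_at_pi_order[of m] unfolding n by (simp only:)
qed

end
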